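(* Let $\mathcal{M}$ be a tree (as an $\mathcal{L}_t$-structure) that is either finite, or infinite with $\aleph_0$-categorical complete theory $T=\mathrm{Th}(\mathcal{M})$. Then there is a tree plan $(\Gamma,\lambda)$ such that $\mathrm{Th}(\mathcal{M})=\mathrm{Th}(\Gamma(\omega)\restriction\mathcal{L}_t)$.
   Context: Trees: the language $\mathcal{L}_t$ has a binary relation $\le$, a constant $\varepsilon$, a binary function $\sqcap$ and a unary function $\mathtt{pred}$. A tree is an $\mathcal{L}_t$-structure in which $\le$ is a partial order with every downset $\{a:a\le b\}$ well-ordered, $\varepsilon$ is the least element, $a\sqcap a'$ is the greatest common lower bound of $a,a'$, $\mathtt{pred}(a)$ is the greatest element strictly below $a$ for $a\ne\varepsilon$, and $\mathtt{pred}(\varepsilon)=\varepsilon$. Tree plans: a tree plan is a pair $(\Gamma,\lambda)$ where $\Gamma\subseteq\omega^{<\omega}$ is a finite set of finite sequences containing the empty sequence $\langle\rangle$ and closed under initial segments, and $\lambda:\Gamma\to\{1,\infty\}$ with $\lambda(\langle\rangle)=1$. $\Gamma(\omega)$ is the set of finite sequences $\langle(i_0,t_0),\dots,(i_n,t_n)\rangle$ (including the empty one) such that $\langle i_0,\dots,i_n\rangle\in\Gamma$ and for each $k\le n$: $t_k=\star$ (a fixed symbol not in $\omega$) if $\lambda(\langle i_0,\dots,i_k\rangle)=1$, and $t_k\in\omega$ if $\lambda(\langle i_0,\dots,i_k\rangle)=\infty$. $\Gamma(\omega)\restriction\mathcal{L}_t$ is the tree on this set with the initial-segment order, root the empty sequence,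 meet the longest common initial segment, and $\mathtt{pred}$ deleting the last entry. *)

theory Defs
  imports Main "HOL-Library.Sublist"
begin

record 'a lt_struct =
  carrier :: "'a set"
  le :: "'a \<Rightarrow> 'a \<Rightarrow> bool"
  eps :: 'a
  meet :: "'a \<Rightarrow> 'a \<Rightarrow> 'a"
  pred :: "'a \<Rightarrow> 'a"

definition lt_structure :: "'a lt_struct \<Rightarrow> bool" where
  "lt_structure S \<longleftrightarrow> eps S \<in> carrier S
     \<and> (\<forall>a\<in>carrier S. \<forall>b\<in>carrier S. meet S a b \<in> carrier S)
     \<and> (\<forall>a\<in>carrier S. pred S a \<in> carrier S)"

datatype tm = Var nat | Eps | Meet tm tm | Pred tm

datatype fm = FEq tm tm | FLe tm tm | FFalse | FImp fm fm | FAll nat fm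

fun eval_tm :: "'a lt_struct \<Rightarrow> (nat \<Rightarrow> 'a) \<Rightarrow> tm \<Rightarrow> 'a" where
  "eval_tm S v (Var n) = v n"
| "eval_tm S v Eps = eps S"
| "eval_tm S v (Meet t u) = meet S (eval_tm S v t) (eval_tm S v u)"
| "eval_tm S v (Pred t) = pred S (eval_tm S v t)"

fun sat :: "'a lt_struct \<Rightarrow> (nat \<Rightarrow> 'a) \<Rightarrow> fm \<Rightarrow> bool" where
  "sat S v (FEq t u) = (eval_tm S v t = eval_tm S v u)"
| "sat S v (FLe t u) = le S (eval_tm S v t) (eval_tm S v u)"
| "sat S v FFalse = False"
| "sat S v (FImp p q) = (sat S v p \<longrightarrow> sat S v q)"
| "sat S v (FAll x p) = (\<forall>a\<in>carrier S. sat S (v(x := a)) p)"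

fun fv_tm :: "tm \<Rightarrow> nat set" where
  "fv_tm (Var n) = {n}"
| "fv_tm Eps = {}"
| "fv_tm (Meet t u) = fv_tm t \<union> fv_tm u"
| "fv_tm (Pred t) = fv_tm t"

fun fv :: "fm \<Rightarrow> nat set" where
  "fv (FEq t u) = fv_tm t \<union> fv_tm u"
| "fv (FLe t u) = fv_tm t \<union> fv_tm u"
| "fv FFalse = {}"
| "fv (FImp p q) = fv p \<union> fv q"
| "fv (FAll x p) = fv p - {x}"

definition sentence :: "fm \<Rightarrow> bool" where
  "sentence p \<longleftrightarrow> fv p = {}"

definition holds :: "'a lt_struct \<Rightarrow> fm \<Rightarrow> bool" where
  "holds S p \<longleftrightarrow> (\<forall>v. (\<forall>n. v n \<in> carrier S) \<longrightarrow> sat S v p)"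

definition Th :: "'a lt_struct \<Rightarrow> fm set" where
  "Th S = {p. sentence p \<and> holds S p}"

definition lt_iso :: "'a lt_struct \<Rightarrow> 'b lt_struct \<Rightarrow> bool" where
  "lt_iso S S' \<longleftrightarrow> (\<exists>f. bij_betw f (carrier S) (carrier S')
     \<and> f (eps S) = eps S'
     \<and> (\<forall>a\<in>carrier S. \<forall>b\<in>carrier S. le S' (f a) (f b) = le S a b)
     \<and> (\<forall>a\<in>carrier S. \<forall>b\<in>carrier S. f (meet S a b) = meet S' (f a) (f b))
     \<and> (\<forall>a\<in>carrier S. f (pred S a) = pred S' (f a)))"

text \<open>Aleph_0-categoricity of Th(M): any two countably infinite models of Th(M) are
  isomorphic.  Countable models are represented (up to isomorphism) by structures
  whose carrier is a subset of nat.\<close>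
definition aleph0_categorical :: "'a lt_struct \<Rightarrow> bool" where
  "aleph0_categorical M \<longleftrightarrow>
     (\<forall>(N1::nat lt_struct) (N2::nat lt_struct).
        lt_structure N1 \<and> lt_structure N2 \<and> infinite (carrier N1) \<and> infinite (carrier N2)
        \<and> Th M \<subseteq> Th N1 \<and> Th M \<subseteq> Th N2 \<longrightarrow> lt_iso N1 N2)"

definition is_tree :: "'a lt_struct \<Rightarrow> bool" where
  "is_tree S \<longleftrightarrow> lt_structure S
   \<and> (\<forall>a\<in>carrier S. le S a a)
   \<and> (\<forall>a\<in>carrier S. \<forall>b\<in>carrier S. le S a b \<and> le S b a \<longrightarrow> a = b)
   \<and> (\<forall>a\<in>carrier S. \<forall>b\<in>carrier S. \<forall>c\<in>carrier S. le S a b \<and> le S b c \<longrightarrow> le S a c)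
   \<comment> \<open>every downset is well-ordered: linearly ordered, and every nonempty subset has a least element\<close>
   \<and> (\<forall>b\<in>carrier S.
        (\<forall>a1\<in>carrier S. \<forall>a2\<in>carrier S. le S a1 b \<and> le S a2 b \<longrightarrow> le S a1 a2 \<or> le S a2 a1)
      \<and> (\<forall>X. X \<subseteq> {a\<in>carrier S. le S a b} \<and> X \<noteq> {} \<longrightarrow> (\<exists>m\<in>X. \<forall>x\<in>X. le S m x)))
   \<and> (\<forall>a\<in>carrier S. le S (eps S) a)
   \<and> (\<forall>a\<in>carrier S. \<forall>a'\<in>carrier S.
        le S (meet S a a') a \<and> le S (meet S a a') a'
      \<and> (\<forall>c\<in>carrier S. le S c a \<and> le S c a' \<longrightarrow> le S c (meet S a a')))
   \<and> (\<forall>a\<in>carrier S. a \<noteq> eps S \<longrightarrow>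
        (le S (pred S a) a \<and> pred S a \<noteq> a
       \<and> (\<forall>c\<in>carrier S. le S c a \<and> c \<noteq> a \<longrightarrow> le S c (pred S a))))
   \<and> pred S (eps S) = eps S"

datatype mult = One | Infty

definition tree_plan :: "nat list set \<Rightarrow> (nat list \<Rightarrow> mult) \<Rightarrow> bool" where
  "tree_plan \<Gamma> lam \<longleftrightarrow> finite \<Gamma> \<and> [] \<in> \<Gamma>
     \<and> (\<forall>s\<in>\<Gamma>. \<forall>k. take k s \<in> \<Gamma>) \<and> lam [] = One"

text \<open>Gamma(omega): the star symbol is represented by None, t in omega by Some t.\<close>
definition Gamma_omega :: "nat list set \<Rightarrow> (nat list \<Rightarrow> mult) \<Rightarrow> (nat \<times> nat option) list set" where
  "Gamma_omega \<Gamma> lam = {s. map fst s \<in> \<Gamma> \<and>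
     (\<forall>k<length s. (lam (take (Suc k) (map fst s)) = One \<longrightarrow> snd (s ! k) = None)
                \<and> (lam (take (Suc k) (map fst s)) = Infty \<longrightarrow> snd (s ! k) \<noteq> None))}"

definition Gamma_omega_tree :: "nat list set \<Rightarrow> (nat list \<Rightarrow> mult) \<Rightarrow> (nat \<times> nat option) list lt_struct" where
  "Gamma_omega_tree \<Gamma> lam = \<lparr> carrier = Gamma_omega \<Gamma> lam, le = prefix, eps = [],
      meet = longest_common_prefix, pred = butlast \<rparr>"

end

theory Submission
  imports Defs "HOL-Library.Countable_Set"
begin

text \<open>
  In a tree of bounded height the first-order theory is determined by the graded modal theory of the
  root, the modality \<open>Dia n\<close> saying that at least \<open>n\<close> children satisfy a formula: an
  Ehrenfeucht-Fraisse strategy matches nodes whose subtrees agree up to a fixed multiplicity.  So if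
  below every node of \<open>M\<close> only finitely many modal theories of children occur, a tree plan is obtained
  bottom-up, keeping every child whose theory occurs finitely often and replacing the others by one
  representative of multiplicity \<open>Infty\<close> per theory.

  Both finiteness conditions follow from categoricity without the Ryll-Nardzewski theorem.  If the
  heights are unbounded, an ultrapower of \<open>M\<close> has a node of infinite height.  If the children of some
  node have infinitely many modal theories, then in an ultrapower this node acquires a child whose
  theory \<open>P\<close> is a limit of theories of its siblings; on the other hand, removing from \<open>M\<close> all children
  realising \<open>P\<close> below nodes where \<open>P\<close> is such a limit changes no modal theory.  In either case
  Loewenheim-Skolem yields two non-isomorphic countable models.
\<close>

section \<open>First-order satisfaction and isomorphism\<close>

text \<open>Modal formulas are never translated into \<open>fm\<close>; isomorphisms, countable
  submodels and ultrapowers are each shown to preserve \<open>msat\<close> directly. Bounded height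
  comes first, because the effect of the deletion on \<open>Th M\<close> is controlled only through
  the game: with height \<open>d\<close> and quantifier rank \<open>r\<close> at most
  \<open>r * d\<close> pairs are added, so multiplicities beyond \<open>r * d\<close> are invisible.
  The deletion has to be selective. Where \<open>P\<close> is not a limit, some formula of
  \<open>P\<close> isolates it among the children, so graded formulas count the children realising
  \<open>P\<close> and these must stay. Where it is a limit, every formula of \<open>P\<close> holds
  at infinitely many other children, so no \<open>Dia n\<close> notices the loss. This replaces an
  omitting types argument. The property separating the two countable models, that some node realises
  \<open>P\<close> below a limit of \<open>P\<close>, speaks of infinitely many formulas and so is
  not a sentence that \<open>Th M\<close> would decide, but isomorphisms preserve it.\<close>

lemma eval_tm_cong: "(\<And>i. i \<in> fv_tm t \<Longrightarrow> v i = w i) \<Longrightarrow> eval_tm S v t = eval_tm S w t"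
  by (induction t) auto

lemma sat_cong: "(\<And>i. i \<in> fv p \<Longrightarrow> v i = w i) \<Longrightarrow> sat S v p = sat S w p"
proof (induction p arbitrary: v w)
  case (FEq t u)
  then have "eval_tm S v t = eval_tm S w t" "eval_tm S v u = eval_tm S w u"
    by (auto intro!: eval_tm_cong)
  then show ?case by simp
next
  case (FLe t u)
  then have "eval_tm S v t = eval_tm S w t" "eval_tm S v u = eval_tm S w u"
    by (auto intro!: eval_tm_cong)
  then show ?case by simp
next
  case (FImp p q)
  have "sat S v p = sat S w p" by (rule FImp.IH) (use FImp.prems in auto)
  moreover have "sat S v q = sat S w q" by (rule FImp.IH) (use FImp.prems in auto)
  ultimately show ?case by simp
next
  case (FAll x p)
  have "sat S (v(x := a)) p = sat S (w(x := a)) p" for a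
    by (rule FAll.IH) (use FAll.prems in auto)
  then show ?case by simp
qed simp

lemma eval_tm_closed:
  "lt_structure S \<Longrightarrow> (\<And>i. v i \<in> carrier S) \<Longrightarrow> eval_tm S v t \<in> carrier S"
  by (induction t) (auto simp: lt_structure_def)

text \<open>A sentence ignores the valuation, so the constant one with value \<open>eps S\<close>
  decides it; isomorphisms and games relate these valuations to each other.\<close>

lemma Th_eq_sat_eps:
  assumes "lt_structure S"
  shows "Th S = {p. sentence p \<and> sat S (\<lambda>_. eps S) p}"
proof -
  have "holds S p \<longleftrightarrow> sat S (\<lambda>_. eps S) p" if "sentence p" for p
    using sat_cong[of p] that assms
    unfolding holds_def sentence_def lt_structure_def by (metis empty_iff)
  then show ?thesis by (auto simp: Th_def)
qed

definition iso_map :: "('a \<Rightarrow> 'b) \<Rightarrow> 'a lt_struct \<Rightarrow> 'b lt_struct \<Rightarrow> bool" where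
  "iso_map f S S' \<longleftrightarrow> bij_betw f (carrier S) (carrier S')
     \<and> f (eps S) = eps S'
     \<and> (\<forall>a\<in>carrier S. \<forall>b\<in>carrier S. le S' (f a) (f b) = le S a b)
     \<and> (\<forall>a\<in>carrier S. \<forall>b\<in>carrier S. f (meet S a b) = meet S' (f a) (f b))
     \<and> (\<forall>a\<in>carrier S. f (pred S a) = pred S' (f a))"

lemma lt_iso_iff: "lt_iso S S' \<longleftrightarrow> (\<exists>f. iso_map f S S')"
  by (simp add: lt_iso_def iso_map_def)

lemma iso_map_inv:
  assumes "iso_map f S S'" "lt_structure S"
  shows "iso_map (inv_into (carrier S) f) S' S"
proof -
  let ?g = "inv_into (carrier S) f"
  have b: "bij_betw f (carrier S) (carrier S')" using assms by (simp add: iso_map_def)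
  have gf: "?g (f x) = x" if "x \<in> carrier S" for x
    using b that by (simp add: bij_betw_inv_into_left)
  have ex: "\<exists>x\<in>carrier S. f x = y" if "y \<in> carrier S'" for y
    using b that by (metis bij_betw_imp_surj_on imageE)
  show ?thesis
    unfolding iso_map_def
  proof (intro conjI ballI)
    show "bij_betw ?g (carrier S') (carrier S)" using b by (rule bij_betw_inv_into)
    show "?g (eps S') = eps S"
    proof -
      have "f (eps S) = eps S'" "eps S \<in> carrier S"
        using assms unfolding iso_map_def lt_structure_def by blast+
      then show ?thesis using gf by metis
    qed
    fix a b assume a: "a \<in> carrier S'"
    obtain x where x: "x \<in> carrier S" "f x = a" using ex a by blast
    have "f (pred S x) = pred S' a" using assms x by (auto simp: iso_map_def)
    moreover have "pred S x \<in> carrier S" using assms x by (auto simp: lt_structure_def)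
    ultimately show "?g (pred S' a) = pred S (?g a)" using gf x by metis
    assume b: "b \<in> carrier S'"
    obtain y where y: "y \<in> carrier S" "f y = b" using ex b by blast
    have "le S' (f x) (f y) = le S x y" using assms(1) x(1) y(1) by (simp add: iso_map_def)
    then show "le S (?g a) (?g b) = le S' a b" using x y gf by metis
    have "f (meet S x y) = meet S' a b" using assms x y by (auto simp: iso_map_def)
    moreover have "meet S x y \<in> carrier S" using assms x y by (auto simp: lt_structure_def)
    ultimately show "?g (meet S' a b) = meet S (?g a) (?g b)" using gf x y by metis
  qed
qed

lemma iso_map_closed: "iso_map f S S' \<Longrightarrow> x \<in> carrier S \<Longrightarrow> f x \<in> carrier S'"
  by (auto simp: iso_map_def bij_betw_def)

lemma iso_map_comp:
  assumes "iso_map f S S'" "iso_map g S' S''"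
  shows "iso_map (g \<circ> f) S S''"
  using assms iso_map_closed[OF assms(1)]
  by (auto simp: iso_map_def bij_betw_trans)

lemma lt_iso_sym: "lt_iso S S' \<Longrightarrow> lt_structure S \<Longrightarrow> lt_iso S' S"
  using iso_map_inv unfolding lt_iso_iff by blast

lemma lt_iso_trans: "lt_iso S S' \<Longrightarrow> lt_iso S' S'' \<Longrightarrow> lt_iso S S''"
  using iso_map_comp unfolding lt_iso_iff by blast

lemma iso_map_structure:
  assumes "iso_map f S S'" "lt_structure S"
  shows "lt_structure S'"
proof -
  have im: "carrier S' = f ` carrier S"
    using assms by (simp add: iso_map_def bij_betw_def)
  show ?thesis
    unfolding lt_structure_def im
    using assms by (auto simp: iso_map_def lt_structure_def) (metis imageI)+
qed

lemma iso_map_eval_tm: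
  assumes "iso_map f S S'" "lt_structure S" "\<And>i. v i \<in> carrier S"
  shows "f (eval_tm S v t) = eval_tm S' (f \<circ> v) t"
  using assms eval_tm_closed[OF assms(2), of v]
  by (induction t) (auto simp: iso_map_def)

lemma iso_map_sat:
  assumes "iso_map f S S'" "lt_structure S" "\<And>i. v i \<in> carrier S"
  shows "sat S v p = sat S' (f \<circ> v) p"
  using assms(3)
proof (induction p arbitrary: v)
  case (FEq t u)
  have "inj_on f (carrier S)" using assms by (auto simp: iso_map_def bij_betw_def)
  then show ?case
    using iso_map_eval_tm[OF assms(1,2), of v, symmetric] eval_tm_closed[OF assms(2), of v] FEq
    by (auto simp: inj_on_eq_iff simp del: comp_apply o_apply)
next
  case (FLe t u)
  then show ?case
    using iso_map_eval_tm[OF assms(1,2), of v, symmetric] eval_tm_closed[OF assms(2), of v] assms(1)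
    by (auto simp: iso_map_def simp del: o_apply)
next
  case (FAll x p)
  have im: "carrier S' = f ` carrier S"
    using assms by (simp add: iso_map_def bij_betw_def)
  have upd: "(f \<circ> v)(x := f a) = f \<circ> v(x := a)" for a by auto
  have "sat S (v(x := a)) p = sat S' ((f \<circ> v)(x := f a)) p" if "a \<in> carrier S" for a
    unfolding upd using FAll.prems that by (intro FAll.IH) auto
  then show ?case by (simp add: im del: o_apply)
qed auto

lemma lt_iso_Th:
  assumes "lt_iso S S'" "lt_structure S"
  shows "Th S = Th S'"
proof -
  obtain f where f: "iso_map f S S'" using assms lt_iso_iff by blast
  have fe: "f \<circ> (\<lambda>_. eps S) = (\<lambda>_. eps S')" using f by (auto simp: iso_map_def)
  have "sat S (\<lambda>_. eps S) p = sat S' (\<lambda>_. eps S') p" for p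
    unfolding fe[symmetric] using f assms by (intro iso_map_sat) (auto simp: lt_structure_def)
  then show ?thesis
    by (simp add: Th_eq_sat_eps[OF assms(2)] Th_eq_sat_eps[OF iso_map_structure[OF f assms(2)]])
qed

lemma countable_structure_iso_nat:
  assumes "lt_structure S" "countable (carrier S)"
  shows "\<exists>N :: nat lt_struct. lt_iso S N \<and> lt_structure N"
proof -
  let ?f = "to_nat_on (carrier S)" and ?g = "from_nat_into (carrier S)"
  have gf: "?g (?f x) = x" if "x \<in> carrier S" for x using assms(2) that by simp
  define N where "N = \<lparr>carrier = ?f ` carrier S, le = (\<lambda>a b. le S (?g a) (?g b)), eps = ?f (eps S),
     meet = (\<lambda>a b. ?f (meet S (?g a) (?g b))), pred = (\<lambda>a. ?f (pred S (?g a)))\<rparr>"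
  have "iso_map ?f S N"
    using assms(2) inj_on_to_nat_on[OF assms(2)] gf by (auto simp: iso_map_def N_def bij_betw_def)
  then show ?thesis using iso_map_structure assms lt_iso_iff by blast
qed

text \<open>\<open>aleph0_categorical\<close> speaks only of carriers inside \<open>nat\<close>.
  Coding by numbers extends it to arbitrary types, even two different ones, as needed to compare a
  submodel of \<open>M\<close> with a submodel of an ultrapower.\<close>

lemma aleph0_categorical_lt_iso:
  assumes cat: "aleph0_categorical M"
    and S: "lt_structure S" "countable (carrier S)" "infinite (carrier S)" "Th S = Th M"
    and S': "lt_structure S'" "countable (carrier S')" "infinite (carrier S')" "Th S' = Th M"
  shows "lt_iso S S'"
proof -

  obtain N N' :: "nat lt_struct" where N: "lt_iso S N" "lt_structure N" and N': "lt_iso S' N'" "lt_structure N'"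
    using countable_structure_iso_nat S S' by metis
  have "infinite (carrier N)" "infinite (carrier N')"
    using N N' S(3) S'(3) by (auto simp: lt_iso_def dest: bij_betw_finite)
  moreover have "Th N = Th M" "Th N' = Th M"
    using lt_iso_Th N N' S S' by metis+
  ultimately have "lt_iso N N'"
    using cat N N' by (simp add: aleph0_categorical_def)
  then have "lt_iso S N'" using N lt_iso_trans by blast
  moreover have "lt_iso N' S'" using N' S' lt_iso_sym by blast
  ultimately show ?thesis by (rule lt_iso_trans)
qed

section \<open>Graded modal logic of the child relation\<close>

definition children :: "'a lt_struct \<Rightarrow> 'a \<Rightarrow> 'a set" where
  "children S x = {c \<in> carrier S. c \<noteq> eps S \<and> pred S c = x}"

text \<open>An injection instead of a cardinality treats finite and infinite sets alike, and its
  \<open>n\<close> values can be chosen coordinatewise in an ultrapower.\<close>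

definition at_least :: "nat \<Rightarrow> 'a set \<Rightarrow> bool" where
  "at_least n X \<longleftrightarrow> (\<exists>y :: nat \<Rightarrow> 'a. inj_on y {..<n} \<and> (\<forall>i<n. y i \<in> X))"

lemma at_least_iff: "at_least n X \<longleftrightarrow> infinite X \<or> n \<le> card X"
proof
  assume "at_least n X"
  then obtain y where y: "inj_on y {..<n}" "y ` {..<n} \<subseteq> X" by (auto simp: at_least_def)
  show "infinite X \<or> n \<le> card X"
    using card_mono[OF _ y(2)] card_image[OF y(1)] by auto
next
  assume "infinite X \<or> n \<le> card X"
  then obtain Y where Y: "Y \<subseteq> X" "finite Y" "card Y = n"
    by (metis infinite_arbitrarily_large obtain_subset_with_card_n)
  then obtain h where "bij_betw h {..<n} Y"
    using ex_bij_betw_nat_finite by (metis atLeast0LessThan)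
  then show "at_least n X"
    using Y unfolding at_least_def bij_betw_def by (metis imageI lessThan_iff subsetD)
qed

lemma at_least_bij: "bij_betw h X Y \<Longrightarrow> at_least n X = at_least n Y"
  using bij_betw_finite bij_betw_same_card unfolding at_least_iff by metis

lemma at_least_mono: "at_least n X \<Longrightarrow> X \<subseteq> Y \<Longrightarrow> at_least n Y"
  unfolding at_least_def by blast

lemma at_least_Suc: "c \<in> X \<Longrightarrow> at_least (Suc n) X \<longleftrightarrow> at_least n (X - {c})"
  using card.remove[of X c] by (cases "finite X") (auto simp: at_least_iff)

lemma at_least_1: "at_least (Suc 0) X \<longleftrightarrow> X \<noteq> {}"
  by (cases "finite X") (auto simp: at_least_iff Suc_le_eq card_gt_0_iff)

datatype mf = MFalse | MImp mf mf | Dia nat mf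

instance mf :: countable by countable_datatype
instance tm :: countable by countable_datatype
instance fm :: countable by countable_datatype

fun msat :: "'a lt_struct \<Rightarrow> 'a \<Rightarrow> mf \<Rightarrow> bool" where
  "msat S x MFalse = False"
| "msat S x (MImp p q) = (msat S x p \<longrightarrow> msat S x q)"
| "msat S x (Dia n p) = at_least n {c \<in> children S x. msat S c p}"

abbreviation MNot :: "mf \<Rightarrow> mf" where "MNot p \<equiv> MImp p MFalse"
abbreviation MAnd :: "mf \<Rightarrow> mf \<Rightarrow> mf" where "MAnd p q \<equiv> MNot (MImp p (MNot q))"

text \<open>Truth at \<open>x\<close> depends only on the child relation above \<open>x\<close>, so
  \<open>h\<close> need be bijective only from children to children, on a set closed under children.
  This serves isomorphisms and also the embedding of a branch into a larger tree.\<close>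

lemma msat_map:
  assumes bij: "\<And>x. x \<in> D \<Longrightarrow> bij_betw h (children S x) (children S' (h x))"
    and D: "\<And>x. x \<in> D \<Longrightarrow> children S x \<subseteq> D" and "x \<in> D"
  shows "msat S' (h x) p = msat S x p"
  using \<open>x \<in> D\<close>
proof (induction p arbitrary: x)
  case (Dia n p)
  have "bij_betw h {c \<in> children S x. msat S c p} {c \<in> children S' (h x). msat S' c p}"
    using bij[OF Dia.prems] Dia.IH D[OF Dia.prems]
    unfolding bij_betw_def inj_on_def by fast
  then show ?case by (simp add: at_least_bij)
qed auto

lemma msat_iso:
  assumes f: "iso_map f S S'" and S: "lt_structure S" and x: "x \<in> carrier S"
  shows "msat S' (f x) p = msat S x p"
proof (rule msat_map[where D = "carrier S"])
  have inj: "inj_on f (carrier S)" and im: "carrier S' = f ` carrier S"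
    using f by (auto simp: iso_map_def bij_betw_def)
  fix x assume x: "x \<in> carrier S"
  show "bij_betw f (children S x) (children S' (f x))"
    unfolding bij_betw_def
  proof
    show "inj_on f (children S x)" using inj by (rule inj_on_subset) (auto simp: children_def)
    have "f c \<in> children S' (f x) \<longleftrightarrow> c \<in> children S x" if "c \<in> carrier S" for c
    proof -
      have "f c = eps S' \<longleftrightarrow> c = eps S" "pred S' (f c) = f x \<longleftrightarrow> pred S c = x"
        using f S that x inj unfolding iso_map_def lt_structure_def by (metis inj_onD)+
      then show ?thesis using that im by (auto simp: children_def)
    qed
    then show "f ` children S x = children S' (f x)"
      using im by (auto simp: children_def image_iff)
  qed
qed (use x in \<open>auto simp: children_def\<close>)

section \<open>Downward Loewenheim-Skolem\<close>

text \<open>Lists are the finite parameter tuples of the operation. Countably many rounds suffice,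
  since a list over the union of increasing stages lies inside a single stage.\<close>

lemma countable_closure:
  fixes H :: "'a list \<Rightarrow> 'a set"
  assumes H: "\<And>l. countable (H l)" and X: "countable X" "X \<subseteq> D"
    and D: "\<And>l. set l \<subseteq> D \<Longrightarrow> H l \<subseteq> D"
  shows "\<exists>C. countable C \<and> X \<subseteq> C \<and> C \<subseteq> D \<and> (\<forall>l. set l \<subseteq> C \<longrightarrow> H l \<subseteq> C)"
proof -
  define G where "G Y = Y \<union> (\<Union>l\<in>lists Y. H l)" for Y
  define E where "E n = (G ^^ n) X" for n
  have mono: "E m \<subseteq> E n" if "m \<le> n" for m n
    by (rule lift_Suc_mono_le[OF _ that]) (auto simp: E_def G_def)
  have cnt: "countable (E n)" for n
    by (induction n) (auto simp: E_def G_def X H)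
  have sub: "E n \<subseteq> D" for n
    using D X(2) by (induction n) (auto simp: E_def G_def, blast)
  have fin: "\<exists>n. set l \<subseteq> E n" if "set l \<subseteq> (\<Union>n. E n)" for l
    using that
  proof (induction l)
    case (Cons a l)
    then obtain n m where "set l \<subseteq> E n" "a \<in> E m" by auto
    then have "set (a # l) \<subseteq> E (max n m)" using mono[of n "max n m"] mono[of m "max n m"] by auto
    then show ?case by blast
  qed auto
  have "H l \<subseteq> (\<Union>n. E n)" if l: "set l \<subseteq> (\<Union>n. E n)" for l
  proof -
    obtain n where "set l \<subseteq> E n" using fin[OF l] by blast
    then have "H l \<subseteq> E (Suc n)" by (auto simp: E_def G_def lists_eq_set)
    then show ?thesis by blast
  qed
  moreover have "X \<subseteq> (\<Union>n. E n)" using UN_upper[of 0 UNIV E] by (simp add: E_def)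
  moreover have "(\<Union>n. E n) \<subseteq> D" using sub by blast
  ultimately show ?thesis using cnt by (intro exI[of _ "\<Union>n. E n"]) auto
qed

lemma countable_shadow:
  "\<exists>Z. countable Z \<and> Z \<subseteq> X \<and> (\<forall>n. at_least n Z \<longleftrightarrow> at_least n X)"
proof (cases "finite X")
  case True
  then show ?thesis by (intro exI[of _ X]) (auto simp: countable_finite)
next
  case False
  then obtain Z where "countable Z" "Z \<subseteq> X" "infinite Z"
    using infinite_countable_subset' by blast
  then show ?thesis using False by (auto simp: at_least_iff)
qed

lemma eval_tm_carrier_update [simp]: "eval_tm (S\<lparr>carrier := C\<rparr>) v t = eval_tm S v t"
  by (induction t) auto

text \<open>The usual closure under witnesses for quantifiers, with one addition: for each node and
  modal formula, a countable set of children with the same finite counts is thrown in. So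
  \<open>msat\<close> survives beside \<open>sat\<close>.\<close>

lemma loewenheim_skolem:
  assumes S: "lt_structure S" and X: "countable X" "X \<subseteq> carrier S" and inf: "infinite (carrier S)"
  obtains C where "countable C" "X \<subseteq> C" "C \<subseteq> carrier S" "infinite C" "lt_structure (S\<lparr>carrier := C\<rparr>)"
    "Th (S\<lparr>carrier := C\<rparr>) = Th S" "\<And>x p. x \<in> C \<Longrightarrow> msat (S\<lparr>carrier := C\<rparr>) x p = msat S x p"
proof -
  \<comment> \<open>The list supplies the values of finitely many variables; all others default to
    the root.\<close>
  define val where "val l i = (if i < length l then l ! i else eps S)" for l and i :: nat
  \<comment> \<open>A counterexample to \<open>p\<close> if there is one, and otherwise still some
    element of the carrier, so that the closure never leaves \<open>S\<close>.\<close>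
  define wit where "wit p x v = (SOME a. a \<in> carrier S \<and> ((\<exists>a\<in>carrier S. \<not> sat S (v(x := a)) p) \<longrightarrow> \<not> sat S (v(x := a)) p))" for p x v
  have wit: "wit p x v \<in> carrier S \<and> ((\<exists>a\<in>carrier S. \<not> sat S (v(x := a)) p) \<longrightarrow> \<not> sat S (v(x := wit p x v)) p)" for p x v
    unfolding wit_def by (rule someI_ex) (use S in \<open>unfold lt_structure_def, blast\<close>)
  define K where "K x p = (SOME Z. countable Z \<and> Z \<subseteq> {c \<in> children S x. msat S c p}
      \<and> (\<forall>n. at_least n Z \<longleftrightarrow> at_least n {c \<in> children S x. msat S c p}))" for x p
  have K: "countable (K x p) \<and> K x p \<subseteq> {c \<in> children S x. msat S c p}
      \<and> (\<forall>n. at_least n (K x p) \<longleftrightarrow> at_least n {c \<in> children S x. msat S c p})" for x p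
    unfolding K_def by (rule someI_ex) (rule countable_shadow)
  obtain Y where Y: "countable Y" "Y \<subseteq> carrier S" "infinite Y"
    using infinite_countable_subset'[OF inf] by blast
  define H where "H l = range (\<lambda>t. eval_tm S (val l) t) \<union> range (\<lambda>(p, x). wit p x (val l))
     \<union> (\<Union>x\<in>set l. \<Union>p. K x p)" for l
  have cH: "countable (H l)" for l
    using K unfolding H_def by (intro countable_Un countable_UN) (auto intro: countable_finite)
  have val: "val l i \<in> carrier S" if "set l \<subseteq> carrier S" for l i
    using that S by (auto simp: val_def lt_structure_def)
  have "H l \<subseteq> carrier S" if l: "set l \<subseteq> carrier S" for l
    using eval_tm_closed[OF S val[OF l]] wit K by (fastforce simp: H_def children_def)
  then obtain C where C: "countable C" "X \<union> Y \<subseteq> C" "C \<subseteq> carrier S" and H: "\<And>l. set l \<subseteq> C \<Longrightarrow> H l \<subseteq> C"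
    using countable_closure[of H "X \<union> Y" "carrier S"] cH X Y by auto
  let ?N = "S\<lparr>carrier := C\<rparr>"
  have N: "lt_structure ?N"
  proof -
    have "eps S \<in> C"
      using H[of "[]"] by (auto simp: H_def image_subset_iff dest: spec[of _ Eps])
    moreover have "meet S a b \<in> C" if "a \<in> C" "b \<in> C" for a b
      using H[of "[a, b]"] that by (auto simp: H_def val_def image_subset_iff dest: spec[of _ "Meet (Var 0) (Var 1)"])
    moreover have "pred S a \<in> C" if "a \<in> C" for a
      using H[of "[a]"] that by (auto simp: H_def val_def image_subset_iff dest: spec[of _ "Pred (Var 0)"])
    ultimately show ?thesis by (auto simp: lt_structure_def)
  qed
  have eC: "eps S \<in> C" using N by (simp add: lt_structure_def)
  have sat: "sat ?N v p = sat S v p" if "\<And>i. v i \<in> C" for v p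
    using that
  proof (induction p arbitrary: v)
    case (FAll x p)
    have IH: "sat ?N (v(x := a)) p = sat S (v(x := a)) p" if "a \<in> C" for a
      by (rule FAll.IH) (use FAll.prems that in auto)
    have "\<exists>a\<in>C. \<not> sat S (v(x := a)) p" if ex: "\<exists>a\<in>carrier S. \<not> sat S (v(x := a)) p"
    proof -
      \<comment> \<open>Only finitely many variables are free in \<open>p\<close>, so the relevant
        part of \<open>v\<close> is a list over \<open>C\<close> and its witness lies in
        \<open>C\<close>.\<close>
      obtain m where m: "\<And>i. i \<in> fv p \<Longrightarrow> i < m"
      proof -
        have "finite (fv_tm t)" for t by (induction t) auto
        then have "finite (fv p)" by (induction p) auto
        then show ?thesis using that by (meson finite_nat_set_iff_bounded)
      qed
      let ?l = "map v [0..<m]"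
      have eq: "sat S (v(x := a)) p = sat S ((val ?l)(x := a)) p" for a
        by (rule sat_cong) (use m in \<open>auto simp: val_def\<close>)
      have "\<not> sat S ((val ?l)(x := wit p x (val ?l))) p" using wit ex eq by blast
      moreover have "wit p x (val ?l) \<in> C"
      proof -
        have "set ?l \<subseteq> C" using FAll.prems by auto
        then have "H ?l \<subseteq> C" by (rule H)
        moreover have "wit p x (val ?l) \<in> range (\<lambda>(p, x). wit p x (val ?l))"
          by (rule image_eqI[of _ _ "(p, x)"]) simp_all
        then have "wit p x (val ?l) \<in> H ?l" by (simp add: H_def)
        ultimately show ?thesis by blast
      qed
      ultimately show ?thesis using eq by blast
    qed
    then show ?case using IH C(3) by auto
  qed auto
  have Th: "Th ?N = Th S"
    using sat[of "\<lambda>_. eps S"] eC by (simp add: Th_eq_sat_eps[OF N] Th_eq_sat_eps[OF S])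
  have "msat ?N x p = msat S x p" if "x \<in> C" for x p
    using that
  proof (induction p arbitrary: x)
    case (Dia n p)
    have ch: "children ?N x = children S x \<inter> C" using C(3) by (auto simp: children_def)
    have "H [x] \<subseteq> C" using Dia.prems by (intro H) simp
    then have "(\<Union>p. K x p) \<subseteq> C" by (simp add: H_def)
    then have "K x p \<subseteq> C" by blast
    then have lo: "K x p \<subseteq> {c \<in> children ?N x. msat ?N c p}"
      using K[of x p] Dia.IH by (auto simp: ch)
    have up: "{c \<in> children ?N x. msat ?N c p} \<subseteq> {c \<in> children S x. msat S c p}"
      using Dia.IH by (auto simp: ch)
    show ?case
      unfolding msat.simps using K[of x p] at_least_mono[OF _ lo] at_least_mono[OF _ up] by blast
  qed auto
  moreover have "infinite C" using C(2) Y(3) finite_subset by blast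
  ultimately show ?thesis using that[of C] C Th N by blast
qed

section \<open>Ultrapowers\<close>

text \<open>Zorn's lemma on families whose finite intersections are infinite, not merely nonempty. A
  maximal such family contains every cofinite set, since the complement of one is finite and cannot
  belong.\<close>

lemma exists_free_ultrafilter:
  "\<exists>U :: nat filter. U \<noteq> bot \<and> U \<le> cofinite \<and> (\<forall>P. eventually P U \<or> eventually (\<lambda>k. \<not> P k) U)"
proof -
  define A where "A = {M :: nat set set. \<forall>F. finite F \<and> F \<subseteq> M \<longrightarrow> infinite (\<Inter>F)}"
  have "\<exists>M\<in>A. \<forall>X\<in>A. M \<subseteq> X \<longrightarrow> X = M"
  proof (rule subset_Zorn')
    fix \<C> assume c: "subset.chain A \<C>"
    show "\<Union>\<C> \<in> A"
    proof (cases "\<C> = {}")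
      case False
      have "infinite (\<Inter>F)" if F: "finite F" "F \<subseteq> \<Union>\<C>" for F
      proof -
        obtain M where "M \<in> \<C>" "F \<subseteq> M"
          using finite_subset_Union_chain[OF F False c] by blast
        then show ?thesis using c F by (auto simp: A_def subset.chain_def)
      qed
      then show ?thesis by (auto simp: A_def)
    qed (auto simp: A_def)
  qed
  then obtain M where M: "M \<in> A" and max: "\<And>X. X \<in> A \<Longrightarrow> M \<subseteq> X \<Longrightarrow> X = M" by blast
  have inf: "infinite (\<Inter>F)" if "finite F" "F \<subseteq> M" for F using M that by (auto simp: A_def)
  \<comment> \<open>By maximality, a set outside \<open>M\<close> meets some finite intersection
    from \<open>M\<close> in a finite set. Two complementary sets outside would then split an
    infinite intersection into two finite parts.\<close>
  have out: "\<exists>F. finite F \<and> F \<subseteq> M \<and> finite (\<Inter>F \<inter> P)" if "P \<notin> M" for P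
  proof -
    have "insert P M \<notin> A" using max[of "insert P M"] that by blast
    then obtain F where F: "finite F" "F \<subseteq> insert P M" "finite (\<Inter>F)" by (auto simp: A_def)
    have "\<Inter>(F - {P}) \<inter> P \<subseteq> \<Inter>F" by auto
    then show ?thesis using F finite_subset by (intro exI[of _ "F - {P}"]) auto
  qed
  have dich: "P \<in> M \<or> - P \<in> M" for P
  proof (rule ccontr)
    assume "\<not> ?thesis"
    then obtain F G where FG: "finite F" "F \<subseteq> M" "finite (\<Inter>F \<inter> P)" "finite G" "G \<subseteq> M" "finite (\<Inter>G \<inter> - P)"
      using out by metis
    have "\<Inter>(F \<union> G) \<subseteq> (\<Inter>F \<inter> P) \<union> (\<Inter>G \<inter> - P)" by auto
    then show False using inf[of "F \<union> G"] FG by (meson finite_UnI finite_subset le_sup_iff)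
  qed
  have meet: "infinite (P \<inter> Q)" if "P \<in> M" "Q \<in> M" for P Q using inf[of "{P, Q}"] that by auto
  have up: "Q \<in> M" if "P \<in> M" "P \<subseteq> Q" for P Q
    using dich[of Q] meet[of P "- Q"] that by (metis disjoint_eq_subset_Compl double_compl finite.emptyI)
  have int: "P \<inter> Q \<in> M" if "P \<in> M" "Q \<in> M" for P Q
  proof (rule ccontr)
    assume "P \<inter> Q \<notin> M"
    then have "infinite (\<Inter>{P, Q, - (P \<inter> Q)})" using dich[of "P \<inter> Q"] that by (intro inf) auto
    moreover have "\<Inter>{P, Q, - (P \<inter> Q)} = {}" by auto
    ultimately show False by simp
  qed
  have cof: "P \<in> M" if "finite (- P)" for P
    using dich[of P] meet[of "- P" "- P"] that by auto
  have "is_filter (\<lambda>P. Collect P \<in> M)"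
  proof
    show "Collect (\<lambda>_. True) \<in> M" using cof by simp
    show "Collect (\<lambda>k. P k \<and> Q k) \<in> M" if "Collect P \<in> M" "Collect Q \<in> M" for P Q
      using int[OF that] by (simp add: Collect_conj_eq)
    show "Collect Q \<in> M" if "\<forall>k. P k \<longrightarrow> Q k" "Collect P \<in> M" for P Q
      using up[OF that(2), of "Collect Q"] that(1) by auto
  qed
  then have ev: "eventually P (Abs_filter (\<lambda>P. Collect P \<in> M)) \<longleftrightarrow> Collect P \<in> M" for P
    by (simp add: eventually_Abs_filter)
  show ?thesis
  proof (intro exI[of _ "Abs_filter (\<lambda>P. Collect P \<in> M)"] conjI allI)
    show "Abs_filter (\<lambda>P. Collect P \<in> M) \<noteq> bot"
      using ev[of "\<lambda>_. False"] meet[of "{}" "{}"] by (auto simp: trivial_limit_def)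
    show "Abs_filter (\<lambda>P. Collect P \<in> M) \<le> cofinite"
      by (rule filter_leI) (simp add: ev cof eventually_cofinite Collect_neg_eq)
    show "eventually P (Abs_filter (\<lambda>P. Collect P \<in> M)) \<or> eventually (\<lambda>k. \<not> P k) (Abs_filter (\<lambda>P. Collect P \<in> M))" for P
      using dich[of "Collect P"] by (simp add: ev Collect_neg_eq)
  qed
qed

locale ultrapower =
  fixes U :: "nat filter" and S :: "'a lt_struct"
  assumes proper: "U \<noteq> bot" and free: "U \<le> cofinite"
    and ultra: "\<And>P. eventually P U \<or> eventually (\<lambda>k. \<not> P k) U"
    and S: "lt_structure S"
begin

text \<open>The class of a sequence is represented by a chosen element of it.\<close>
definition rep :: "(nat \<Rightarrow> 'a) \<Rightarrow> nat \<Rightarrow> 'a" where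
  "rep f = (SOME g. (\<forall>k. g k \<in> carrier S) \<and> eventually (\<lambda>k. g k = f k) U)"

definition upow :: "(nat \<Rightarrow> 'a) lt_struct" where
  "upow = \<lparr>carrier = {rep f |f. \<forall>k. f k \<in> carrier S},
     le = (\<lambda>f g. eventually (\<lambda>k. le S (f k) (g k)) U),
     eps = rep (\<lambda>_. eps S),
     meet = (\<lambda>f g. rep (\<lambda>k. meet S (f k) (g k))),
     pred = (\<lambda>f. rep (\<lambda>k. pred S (f k)))\<rparr>"

lemma rep:
  assumes "\<And>k. f k \<in> carrier S"
  shows "rep f k \<in> carrier S" "eventually (\<lambda>k. rep f k = f k) U"
proof -
  have "(\<forall>k. rep f k \<in> carrier S) \<and> eventually (\<lambda>k. rep f k = f k) U"
    unfolding rep_def by (rule someI[of _ f]) (use assms in auto)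
  then show "rep f k \<in> carrier S" "eventually (\<lambda>k. rep f k = f k) U" by auto
qed

lemma rep_eqI:
  assumes e: "eventually (\<lambda>k. f k = g k) U"
  shows "rep f = rep g"
proof -
  have "eventually (\<lambda>k. h k = f k) U \<longleftrightarrow> eventually (\<lambda>k. h k = g k) U" for h
  proof
    show "eventually (\<lambda>k. h k = g k) U" if "eventually (\<lambda>k. h k = f k) U"
      using e that by eventually_elim simp
    show "eventually (\<lambda>k. h k = f k) U" if "eventually (\<lambda>k. h k = g k) U"
      using e that by eventually_elim simp
  qed
  then show ?thesis by (simp add: rep_def)
qed

lemma upow_in: "f \<in> carrier upow \<Longrightarrow> f k \<in> carrier S"
  by (auto simp: upow_def rep)

lemma rep_in [simp]: "(\<And>k. f k \<in> carrier S) \<Longrightarrow> rep f \<in> carrier upow"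
  by (auto simp: upow_def)

lemma rep_id: "f \<in> carrier upow \<Longrightarrow> rep f = f"
  by (auto simp: upow_def intro!: rep_eqI rep)

lemma upow_eq_iff:
  assumes "f \<in> carrier upow" "g \<in> carrier upow"
  shows "f = g \<longleftrightarrow> eventually (\<lambda>k. f k = g k) U"
  using rep_eqI[of f g] rep_id assms by auto

lemma ev_not: "eventually (\<lambda>k. \<not> P k) U \<longleftrightarrow> \<not> eventually P U"
proof
  assume "eventually (\<lambda>k. \<not> P k) U"
  then show "\<not> eventually P U"
    using proper eventually_conj[of "\<lambda>k. \<not> P k" U P] by (auto simp: trivial_limit_def)
qed (use ultra in blast)

lemma ev_imp: "eventually (\<lambda>k. P k \<longrightarrow> Q k) U \<longleftrightarrow> (eventually P U \<longrightarrow> eventually Q U)"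
proof
  assume "eventually P U \<longrightarrow> eventually Q U"
  then consider "eventually (\<lambda>k. \<not> P k) U" | "eventually Q U" using ev_not[of P] by auto
  then show "eventually (\<lambda>k. P k \<longrightarrow> Q k) U" by cases (auto elim: eventually_mono)
qed (auto elim: eventually_elim2)

lemma upow_structure:
  shows "lt_structure upow"
  using S upow_in by (auto simp: lt_structure_def upow_def rep intro!: exI)

lemma ev_eps: "eventually (\<lambda>k. eps upow k = eps S) U"
  using rep(2)[of "\<lambda>_. eps S"] S by (simp add: upow_def lt_structure_def)

lemma ev_pred: "f \<in> carrier upow \<Longrightarrow> eventually (\<lambda>k. pred upow f k = pred S (f k)) U"
  using rep(2)[of "\<lambda>k. pred S (f k)"] S upow_in[of f] by (simp add: upow_def lt_structure_def)

lemma ev_meet: "f \<in> carrier upow \<Longrightarrow> g \<in> carrier upow \<Longrightarrow>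
    eventually (\<lambda>k. meet upow f g k = meet S (f k) (g k)) U"
  using rep(2)[of "\<lambda>k. meet S (f k) (g k)"] S upow_in[of f] upow_in[of g] by (simp add: upow_def lt_structure_def)

lemma ev_eval_tm:
  assumes "\<And>i. v i \<in> carrier upow"
  shows "eventually (\<lambda>k. eval_tm upow v t k = eval_tm S (\<lambda>i. v i k) t) U"
proof (induction t)
  case Eps
  then show ?case using ev_eps by simp
next
  case (Meet t u)
  have "eventually (\<lambda>k. meet upow (eval_tm upow v t) (eval_tm upow v u) k = meet S (eval_tm upow v t k) (eval_tm upow v u k)) U"
    by (intro ev_meet eval_tm_closed[OF upow_structure] assms)
  with Meet show ?case by eventually_elim simp
next
  case (Pred t)
  have "eventually (\<lambda>k. pred upow (eval_tm upow v t) k = pred S (eval_tm upow v t k)) U"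
    by (intro ev_pred eval_tm_closed[OF upow_structure] assms)
  with Pred show ?case by eventually_elim simp
qed simp

theorem los:
  assumes "\<And>i. v i \<in> carrier upow"
  shows "sat upow v p \<longleftrightarrow> eventually (\<lambda>k. sat S (\<lambda>i. v i k) p) U"
  using assms
proof (induction p arbitrary: v)
  case (FEq t u)
  have e: "eventually (\<lambda>k. eval_tm upow v t k = eval_tm S (\<lambda>i. v i k) t \<and> eval_tm upow v u k = eval_tm S (\<lambda>i. v i k) u) U"
    by (intro eventually_conj ev_eval_tm FEq)
  have "sat upow v (FEq t u) \<longleftrightarrow> eventually (\<lambda>k. eval_tm upow v t k = eval_tm upow v u k) U"
    using upow_eq_iff[OF eval_tm_closed[OF upow_structure FEq] eval_tm_closed[OF upow_structure FEq]] by simp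
  also have "\<dots> \<longleftrightarrow> eventually (\<lambda>k. sat S (\<lambda>i. v i k) (FEq t u)) U"
    by (rule eventually_subst) (use e in \<open>eventually_elim; simp\<close>)
  finally show ?case .
next
  case (FLe t u)
  have e: "eventually (\<lambda>k. eval_tm upow v t k = eval_tm S (\<lambda>i. v i k) t \<and> eval_tm upow v u k = eval_tm S (\<lambda>i. v i k) u) U"
    by (intro eventually_conj ev_eval_tm FLe)
  have "sat upow v (FLe t u) \<longleftrightarrow> eventually (\<lambda>k. le S (eval_tm upow v t k) (eval_tm upow v u k)) U"
    by (simp add: upow_def)
  also have "\<dots> \<longleftrightarrow> eventually (\<lambda>k. sat S (\<lambda>i. v i k) (FLe t u)) U"
    by (rule eventually_subst) (use e in \<open>eventually_elim; simp\<close>)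
  finally show ?case .
next
  case FFalse
  then show ?case using proper by (simp add: trivial_limit_def[symmetric])
next
  case (FImp p q)
  then show ?case by (simp add: ev_imp)
next
  case (FAll x p)
  have IH: "sat upow (v(x := f)) p \<longleftrightarrow> eventually (\<lambda>k. sat S ((\<lambda>i. v i k)(x := f k)) p) U"
    if "f \<in> carrier upow" for f
  proof -
    have eq: "(\<lambda>i. v i k)(x := f k) = (\<lambda>i. (v(x := f)) i k)" for k by auto
    show ?thesis unfolding eq by (rule FAll.IH) (use FAll.prems that in auto)
  qed
  show ?case
  proof
    assume L: "sat upow v (FAll x p)"
    \<comment> \<open>A counterexample at every coordinate that has one: if the class of this single
      sequence satisfies \<open>p\<close>, almost no coordinate has a counterexample.\<close>
    define f where "f k = (SOME a. a \<in> carrier S \<and> ((\<exists>a\<in>carrier S. \<not> sat S ((\<lambda>i. v i k)(x := a)) p) \<longrightarrow> \<not> sat S ((\<lambda>i. v i k)(x := a)) p))" for k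
    have f: "f k \<in> carrier S \<and> ((\<exists>a\<in>carrier S. \<not> sat S ((\<lambda>i. v i k)(x := a)) p) \<longrightarrow> \<not> sat S ((\<lambda>i. v i k)(x := f k)) p)" for k
      unfolding f_def by (rule someI_ex) (use S in \<open>unfold lt_structure_def, blast\<close>)
    have "eventually (\<lambda>k. sat S ((\<lambda>i. v i k)(x := rep f k)) p) U"
      using L IH[of "rep f"] f by simp
    moreover have "eventually (\<lambda>k. rep f k = f k) U" using f by (intro rep) auto
    ultimately show "eventually (\<lambda>k. sat S (\<lambda>i. v i k) (FAll x p)) U"
      by eventually_elim (use f in auto)
  next
    assume R: "eventually (\<lambda>k. sat S (\<lambda>i. v i k) (FAll x p)) U"
    have "eventually (\<lambda>k. sat S ((\<lambda>i. v i k)(x := f k)) p) U" if "f \<in> carrier upow" for f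
      using R by eventually_elim (use upow_in[OF that] in auto)
    then show "sat upow v (FAll x p)" using IH by simp
  qed
qed

lemma Th_upow: "Th upow = Th S"
proof -
  have "sat upow (\<lambda>_. eps upow) p \<longleftrightarrow> sat S (\<lambda>_. eps S) p" for p
  proof -
    have "sat upow (\<lambda>_. eps upow) p \<longleftrightarrow> eventually (\<lambda>k. sat S (\<lambda>_. eps upow k) p) U"
      using upow_structure by (intro los) (simp add: lt_structure_def)
    also have "\<dots> \<longleftrightarrow> eventually (\<lambda>k. sat S (\<lambda>_. eps S) p) U"
      by (rule eventually_subst) (use ev_eps in \<open>eventually_elim; simp\<close>)
    finally show ?thesis using proper by (cases "sat S (\<lambda>_. eps S) p") (auto simp: trivial_limit_def)
  qed
  then show ?thesis by (simp add: Th_eq_sat_eps[OF S] Th_eq_sat_eps[OF upow_structure])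
qed

lemma children_upow:
  assumes "f \<in> carrier upow" "c \<in> carrier upow"
  shows "c \<in> children upow f \<longleftrightarrow> eventually (\<lambda>k. c k \<in> children S (f k)) U"
proof -
  have p: "pred upow c \<in> carrier upow" and e: "eps upow \<in> carrier upow"
    using upow_structure assms by (auto simp: lt_structure_def)
  have "c \<in> children upow f \<longleftrightarrow> eventually (\<lambda>k. c k \<noteq> eps upow k \<and> pred upow c k = f k) U"
    using assms upow_eq_iff[OF assms(2) e] upow_eq_iff[OF p assms(1)]
    by (simp add: children_def eventually_conj_iff ev_not)
  also have "\<dots> \<longleftrightarrow> eventually (\<lambda>k. c k \<in> children S (f k)) U"
    by (rule eventually_subst)
      (use ev_eps ev_pred[OF assms(2)] in \<open>eventually_elim; use upow_in[OF assms(2)] in \<open>simp add: children_def\<close>\<close>)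
  finally show ?thesis .
qed

text \<open>For \<open>Dia\<close>, finitely many distinct classes are separated simultaneously at
  almost all coordinates; conversely, \<open>n\<close> distinct children chosen at each coordinate
  give \<open>n\<close> distinct classes.\<close>

lemma los_msat: "f \<in> carrier upow \<Longrightarrow> msat upow f p \<longleftrightarrow> eventually (\<lambda>k. msat S (f k) p) U"
proof (induction p arbitrary: f)
  case MFalse
  then show ?case using proper by (simp add: trivial_limit_def[symmetric])
next
  case (MImp p q)
  then show ?case by (simp add: ev_imp)
next
  case (Dia n p)
  have mem: "c \<in> {c \<in> children upow f. msat upow c p} \<longleftrightarrow>
      eventually (\<lambda>k. c k \<in> {c \<in> children S (f k). msat S c p}) U" if "c \<in> carrier upow" for c
    using Dia that children_upow by (simp add: eventually_conj_iff)
  show ?case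
  proof
    assume "msat upow f (Dia n p)"
    then obtain y where inj: "inj_on y {..<n}" and y: "\<And>i. i < n \<Longrightarrow> y i \<in> {c \<in> children upow f. msat upow c p}"
      by (auto simp: at_least_def)
    have c: "y i \<in> carrier upow" if "i < n" for i using y[OF that] by (simp add: children_def)
    have "eventually (\<lambda>k. \<forall>i\<in>{..<n}. \<forall>j\<in>{..<n}. i \<noteq> j \<longrightarrow> y i k \<noteq> y j k) U"
    proof (intro eventually_ball_finite ballI finite_lessThan)
      fix i j assume "i \<in> {..<n}" "j \<in> {..<n}"
      then show "eventually (\<lambda>k. i \<noteq> j \<longrightarrow> y i k \<noteq> y j k) U"
        using inj upow_eq_iff[of "y i" "y j"] c by (cases "i = j") (auto simp: ev_not inj_on_def)
    qed
    moreover have "eventually (\<lambda>k. \<forall>i\<in>{..<n}. y i k \<in> {c \<in> children S (f k). msat S c p}) U"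
      using mem c y by (intro eventually_ball_finite ballI finite_lessThan) auto
    ultimately show "eventually (\<lambda>k. msat S (f k) (Dia n p)) U"
    proof eventually_elim
      case (elim k)
      then show ?case
        unfolding msat.simps at_least_def by (intro exI[of _ "\<lambda>i. y i k"]) (auto simp: inj_on_def)
    qed
  next
    assume R: "eventually (\<lambda>k. msat S (f k) (Dia n p)) U"
    have "\<exists>y. (\<forall>i. y i \<in> carrier S) \<and> (msat S (f k) (Dia n p) \<longrightarrow>
       inj_on y {..<n} \<and> (\<forall>i<n. y i \<in> {c \<in> children S (f k). msat S c p}))" for k
    proof (cases "msat S (f k) (Dia n p)")
      case True
      then obtain y where y: "inj_on y {..<n}" "\<forall>i<n. y i \<in> {c \<in> children S (f k). msat S c p}"
        by (auto simp: at_least_def)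
      then show ?thesis
        using S by (intro exI[of _ "\<lambda>i. if i < n then y i else eps S"])
          (auto simp: inj_on_def children_def lt_structure_def)
    next
      case False
      then show ?thesis using S by (intro exI[of _ "\<lambda>_. eps S"]) (auto simp: lt_structure_def)
    qed
    then obtain y where y: "\<And>k i. y k i \<in> carrier S"
      and y': "\<And>k. msat S (f k) (Dia n p) \<Longrightarrow>
         inj_on (y k) {..<n} \<and> (\<forall>i<n. y k i \<in> {c \<in> children S (f k). msat S c p})" by metis
    let ?z = "\<lambda>i. rep (\<lambda>k. y k i)"
    have z: "?z i \<in> carrier upow" "eventually (\<lambda>k. ?z i k = y k i) U" for i
      using y by (auto intro: rep)
    have "?z i \<in> {c \<in> children upow f. msat upow c p}" if "i < n" for i
      unfolding mem[OF z(1)] using z(2)[of i] R by eventually_elim (use y' that in auto)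
    moreover have "inj_on ?z {..<n}"
    proof (rule inj_onI, rule ccontr)
      fix i j assume ij: "i \<in> {..<n}" "j \<in> {..<n}" "?z i = ?z j" "i \<noteq> j"
      have "eventually (\<lambda>k. ?z i k \<noteq> ?z j k) U"
        using z(2)[of i] z(2)[of j] R by eventually_elim (use y' ij in \<open>auto dest: inj_onD\<close>)
      then show False using ij proper by (simp add: trivial_limit_def)
    qed
    ultimately show "msat upow f (Dia n p)" unfolding msat.simps at_least_def by (intro exI[of _ ?z]) auto
  qed
qed

end

section \<open>Back-and-forth on trees of bounded height\<close>

text \<open>What the game needs, in a form shared by \<open>M\<close>, its pruned version and the
  tree of a plan. Since the order is tied to iterates of \<open>pred\<close>, a matching closed
  under \<open>pred\<close> and respecting equality also respects the order.\<close>

definition bounded_tree :: "nat \<Rightarrow> 'a lt_struct \<Rightarrow> bool" where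
  "bounded_tree d S \<longleftrightarrow> lt_structure S \<and> pred S (eps S) = eps S
     \<and> (\<forall>x\<in>carrier S. (pred S ^^ d) x = eps S)
     \<and> (\<forall>x\<in>carrier S. \<forall>y\<in>carrier S. le S x y \<longleftrightarrow> (\<exists>i. x = (pred S ^^ i) y))
     \<and> (\<forall>x\<in>carrier S. \<forall>y\<in>carrier S. le S (meet S x y) x \<and> le S (meet S x y) y
          \<and> (\<forall>c\<in>carrier S. le S c x \<and> le S c y \<longrightarrow> le S c (meet S x y)))"

definition level :: "'a lt_struct \<Rightarrow> 'a \<Rightarrow> nat" where
  "level S x = (LEAST n. (pred S ^^ n) x = eps S)"

lemma pred_pow_closed: "lt_structure S \<Longrightarrow> x \<in> carrier S \<Longrightarrow> (pred S ^^ n) x \<in> carrier S"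
  by (induction n) (auto simp: lt_structure_def)

lemma pred_pow_eps: "pred S (eps S) = eps S \<Longrightarrow> (pred S ^^ n) (eps S) = eps S"
  by (induction n) auto

lemma bounded_tree_mono:
  assumes "bounded_tree d S" "d \<le> e"
  shows "bounded_tree e S"
proof -
  obtain m where e: "e = m + d" using assms(2) by (metis add.commute le_Suc_ex)
  have "(pred S ^^ e) x = eps S" if "x \<in> carrier S" for x
    using assms(1) that pred_pow_eps[of S] by (simp add: e funpow_add bounded_tree_def)
  then show ?thesis using assms(1) by (simp add: bounded_tree_def)
qed

lemma level_le: "bounded_tree d S \<Longrightarrow> x \<in> carrier S \<Longrightarrow> level S x \<le> d"
  unfolding level_def bounded_tree_def by (auto intro: Least_le)

lemma level_child:
  assumes "bounded_tree d S" "c \<in> children S x"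
  shows "level S c = Suc (level S x)"
proof -
  have "(LEAST n. (pred S ^^ n) c = eps S) = Suc (LEAST m. (pred S ^^ Suc m) c = eps S)"
    by (rule Least_Suc[where n = d]) (use assms in \<open>auto simp: bounded_tree_def children_def\<close>)
  then show ?thesis
    using assms(2) by (simp add: level_def children_def funpow_swap1)
qed

text \<open>Two comparable steps in opposite directions form a \<open>pred\<close>-cycle. Traversing
  a cycle of positive length \<open>d\<close> times makes at least \<open>d\<close> steps and so
  ends at the root, whence \<open>x\<close>, and with it \<open>y\<close>, is the root.\<close>

lemma bounded_tree_antisym:
  assumes S: "bounded_tree d S" and xy: "x \<in> carrier S" "y \<in> carrier S" "le S x y" "le S y x"
  shows "x = y"
proof -
  have le: "le S a b \<longleftrightarrow> (\<exists>i. a = (pred S ^^ i) b)" if "a \<in> carrier S" "b \<in> carrier S" for a b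
    using S that by (simp add: bounded_tree_def)
  obtain i j where i: "x = (pred S ^^ i) y" and j: "y = (pred S ^^ j) x"
    using xy le by blast
  show ?thesis
  proof (cases "i + j")
    case (Suc n)
    have x: "(pred S ^^ (i + j)) x = x" using i j by (simp add: funpow_add)
    have "((pred S ^^ (i + j)) ^^ d) x = x" by (induction d) (simp_all add: x)
    moreover have "((pred S ^^ (i + j)) ^^ d) x = eps S"
    proof -
      have "((pred S ^^ (i + j)) ^^ d) x = (pred S ^^ (n * d + d)) x"
        by (simp only: funpow_mult Suc mult_Suc add.commute)
      also have "\<dots> = eps S"
        using S xy(1) pred_pow_eps[of S] by (simp add: funpow_add bounded_tree_def)
      finally show ?thesis .
    qed
    ultimately have "x = eps S" by simp
    then show ?thesis using j S pred_pow_eps[of S j] by (simp add: bounded_tree_def)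
  qed (use i in simp)
qed

section \<open>Characteristic formulas and positions of the game\<close>

text \<open>The formulas in \<open>chars bs\<close> describe the possible truth assignments to \<open>bs\<close>, so that
  \<open>basis q e\<close> determines the tree of height \<open>e\<close> above a node up to multiplicities capped at \<open>q\<close>.\<close>

fun chars :: "mf list \<Rightarrow> mf list" where
  "chars [] = [MNot MFalse]"
| "chars (b # bs) = concat (map (\<lambda>c. [MAnd b c, MAnd (MNot b) c]) (chars bs))"

fun basis :: "nat \<Rightarrow> nat \<Rightarrow> mf list" where
  "basis q 0 = []"
| "basis q (Suc e) = concat (map (\<lambda>j. map (Dia j) (chars (basis q e))) [0..<Suc q])"

lemma Dia_in_basis: "p \<in> set (chars (basis q e)) \<Longrightarrow> j \<le> q \<Longrightarrow> Dia j p \<in> set (basis q (Suc e))"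
  by (auto simp del: upt_Suc)

lemma ex_char: "\<exists>c\<in>set (chars bs). msat S x c"
  by (induction bs) auto

lemma char_agree:
  "c \<in> set (chars bs) \<Longrightarrow> msat S x c \<Longrightarrow> msat S' y c \<longleftrightarrow> (\<forall>b\<in>set bs. msat S' y b = msat S x b)"
  by (induction bs arbitrary: c) auto

text \<open>A position of the game with remaining budget \<open>k\<close>: counts of still unmatched
  children agree up to \<open>k\<close>. A child of a node at level \<open>l\<close> carries a
  subtree of height at most \<open>d - Suc l\<close>, hence that index of \<open>basis\<close>.
  Closure under \<open>pred\<close> lets the ancestors come along with each node.\<close>

definition partial_match ::
    "nat \<Rightarrow> nat \<Rightarrow> nat \<Rightarrow> 'a lt_struct \<Rightarrow> 'b lt_struct \<Rightarrow> ('a \<times> 'b) set \<Rightarrow> bool" where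
  "partial_match d q k S S' R \<longleftrightarrow> (eps S, eps S') \<in> R \<and> R \<subseteq> carrier S \<times> carrier S'
     \<and> (\<forall>x y. (x, y) \<in> R \<longrightarrow> (pred S x, pred S' y) \<in> R)
     \<and> (\<forall>x y x' y'. (x, y) \<in> R \<longrightarrow> (x', y') \<in> R \<longrightarrow> x = x' \<longleftrightarrow> y = y')
     \<and> (\<forall>x y. (x, y) \<in> R \<longrightarrow> level S x < d \<longrightarrow> (\<forall>c\<in>set (chars (basis q (d - Suc (level S x)))). \<forall>j\<le>k.
          at_least j {u \<in> children S x - Domain R. msat S u c}
          \<longleftrightarrow> at_least j {u \<in> children S' y - Range R. msat S' u c}))"

lemma partial_match_mono: "partial_match d q k S S' R \<Longrightarrow> k' \<le> k \<Longrightarrow> partial_match d q k' S S' R"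
  unfolding partial_match_def by (meson le_trans)

lemma partial_matchD:
  assumes "partial_match d q k S S' R"
  shows "(eps S, eps S') \<in> R" "\<And>x y. (x, y) \<in> R \<Longrightarrow> x \<in> carrier S" "\<And>x y. (x, y) \<in> R \<Longrightarrow> y \<in> carrier S'"
    "\<And>x y. (x, y) \<in> R \<Longrightarrow> (pred S x, pred S' y) \<in> R"
    "\<And>x y x' y'. (x, y) \<in> R \<Longrightarrow> (x', y') \<in> R \<Longrightarrow> x = x' \<longleftrightarrow> y = y'"
    "\<And>x y c j. (x, y) \<in> R \<Longrightarrow> level S x < d \<Longrightarrow> c \<in> set (chars (basis q (d - Suc (level S x)))) \<Longrightarrow> j \<le> k \<Longrightarrow>
          at_least j {u \<in> children S x - Domain R. msat S u c}
          \<longleftrightarrow> at_least j {u \<in> children S' y - Range R. msat S' u c}"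
  using assms unfolding partial_match_def by blast+

lemma partial_match_pow:
  "partial_match d q k S S' R \<Longrightarrow> (x, y) \<in> R \<Longrightarrow> ((pred S ^^ i) x, (pred S' ^^ i) y) \<in> R"
  by (induction i) (auto simp: partial_match_def)

lemma partial_match_level:
  assumes "partial_match d q k S S' R" "(x, y) \<in> R"
  shows "level S x = level S' y"
proof -
  have "(pred S ^^ n) x = eps S \<longleftrightarrow> (pred S' ^^ n) y = eps S'" for n
    using partial_match_pow[OF assms] partial_matchD(1)[OF assms(1)] partial_matchD(5)[OF assms(1)] by blast
  then show ?thesis by (simp add: level_def)
qed

lemma partial_match_sym:
  assumes "partial_match d q k S S' R"
  shows "partial_match d q k S' S (R\<inverse>)"
  unfolding partial_match_def
proof (intro conjI allI impI ballI)
  fix y x c j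
  assume yx: "(y, x) \<in> R\<inverse>" and l: "level S' y < d"
    and c: "c \<in> set (chars (basis q (d - Suc (level S' y))))" and j: "j \<le> k"
  have "level S' y = level S x" using partial_match_level[OF assms] yx by simp
  then show "at_least j {u \<in> children S' y - Domain (R\<inverse>). msat S' u c} =
     at_least j {u \<in> children S x - Range (R\<inverse>). msat S u c}"
    using partial_matchD(6)[OF assms, of x y c j] yx l c j by simp
next
  show "(eps S', eps S) \<in> R\<inverse>" using partial_matchD(1)[OF assms] by simp
  show "R\<inverse> \<subseteq> carrier S' \<times> carrier S" using partial_matchD(2,3)[OF assms] by auto
  show "(pred S' y, pred S x) \<in> R\<inverse>" if "(y, x) \<in> R\<inverse>" for x y
    using partial_matchD(4)[OF assms] that by auto
  show "y = y' \<longleftrightarrow> x = x'" if "(y, x) \<in> R\<inverse>" "(y', x') \<in> R\<inverse>" for x y x' y'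
    using partial_matchD(5)[OF assms, of x y x' y'] that by auto
qed

text \<open>The answer to \<open>c\<close> is an unmatched child with the same characteristic
  formula, which exists because the budget is positive. Old pairs lose at most one candidate on each
  side, which costs one unit; the new pair needs counts up to \<open>k \<le> q\<close>, and the
  formula records these.\<close>

lemma partial_match_extend_child:
  assumes S: "bounded_tree d S" and S': "bounded_tree d S'"
    and R: "partial_match d q (Suc k) S S' R" and kq: "k \<le> q"
    and xy: "(x, y) \<in> R" and c: "c \<in> children S x" "c \<notin> Domain R"
  shows "\<exists>c'. partial_match d q k S S' (insert (c, c') R)"
proof -
  note D = partial_matchD[OF R]
  have lc: "level S c = Suc (level S x)" using level_child[OF S c(1)] .
  have cS: "c \<in> carrier S" "pred S c = x" "c \<noteq> eps S" using c by (auto simp: children_def)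
  have lx: "level S x < d" using level_le[OF S cS(1)] lc by simp
  let ?B = "basis q (d - Suc (level S x))"
  obtain \<chi> where \<chi>: "\<chi> \<in> set (chars ?B)" "msat S c \<chi>" using ex_char by metis
  have "at_least (Suc 0) {u \<in> children S x - Domain R. msat S u \<chi>}"
    using c \<chi> by (auto simp: at_least_1)
  then have "at_least (Suc 0) {u \<in> children S' y - Range R. msat S' u \<chi>}"
    using D(6)[OF xy lx \<chi>(1), of "Suc 0"] by simp
  then obtain c' where c': "c' \<in> children S' y" "c' \<notin> Range R" "msat S' c' \<chi>"
    by (auto simp: at_least_1)
  have cS': "c' \<in> carrier S'" "pred S' c' = y" "c' \<noteq> eps S'" using c' by (auto simp: children_def)
  have agree: "msat S' c' b = msat S c b" if "b \<in> set ?B" for b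
    using char_agree[OF \<chi>, of S' c'] c'(3) that by blast
  have agree_char: "msat S' c' p \<longleftrightarrow> msat S c p" if p: "p \<in> set (chars ?B)" for p
    using char_agree[OF p, of S' c' S c] char_agree[OF p, of S c S' c'] agree by blast
  let ?R = "insert (c, c') R"
  have "partial_match d q k S S' ?R"
    unfolding partial_match_def
  proof (intro conjI allI impI ballI)
    show "(eps S, eps S') \<in> ?R" using D(1) by simp
    show "?R \<subseteq> carrier S \<times> carrier S'" using D(2,3) cS cS' by auto
    show "(pred S u, pred S' w) \<in> ?R" if "(u, w) \<in> ?R" for u w
      using that D(4) cS cS' xy by auto
    show "u = u' \<longleftrightarrow> w = w'" if "(u, w) \<in> ?R" "(u', w') \<in> ?R" for u w u' w'
      using that D(5)[of u w u' w'] c(2) c'(2) by auto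
    fix u w p j
    assume uw: "(u, w) \<in> ?R" and l: "level S u < d"
      and p: "p \<in> set (chars (basis q (d - Suc (level S u))))" and j: "j \<le> k"
    let ?X = "{v \<in> children S u - Domain R. msat S v p}"
    let ?Y = "{v \<in> children S' w - Range R. msat S' v p}"
    have X': "{v \<in> children S u - Domain ?R. msat S v p} = ?X - {c}"
      and Y': "{v \<in> children S' w - Range ?R. msat S' v p} = ?Y - {c'}" by auto
    show "at_least j {v \<in> children S u - Domain ?R. msat S v p} =
       at_least j {v \<in> children S' w - Range ?R. msat S' v p}"
    proof (cases "(u, w) \<in> R")
      case True
      have ux: "u = x \<longleftrightarrow> w = y" using D(5)[OF True xy] .
      have cc: "c \<in> ?X \<longleftrightarrow> c' \<in> ?Y"
        using ux cS cS' c c' agree_char p by (auto simp: children_def)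
      show ?thesis
      proof (cases "c \<in> ?X")
        case True
        then show ?thesis
          unfolding X' Y' using cc at_least_Suc[of c ?X j] at_least_Suc[of c' ?Y j]
            D(6)[OF \<open>(u, w) \<in> R\<close> l p, of "Suc j"] j by simp
      next
        case False
        then have "?X - {c} = ?X" "?Y - {c'} = ?Y" using cc by auto
        then show ?thesis
          unfolding X' Y' using D(6)[OF \<open>(u, w) \<in> R\<close> l p, of j] j by simp
      qed
    next
      case False
      then have uw: "u = c" "w = c'" using uw by auto
      have "level S' y = level S x" using partial_match_level[OF R xy] by simp
      then have lc': "level S' c' = level S c" using level_child[OF S' c'(1)] lc by simp
      \<comment> \<open>A matched child of \<open>c\<close> would put its \<open>pred\<close>, that
        is \<open>c\<close>, into the domain of \<open>R\<close>; hence all children of the new pair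
        are still unmatched.\<close>
      have "children S c \<inter> Domain ?R = {}"
      proof -
        have "pred S v \<in> Domain R" if "v \<in> Domain R" for v using that D(4) by blast
        moreover have "c \<notin> children S c" using level_child[OF S, of c c] by auto
        ultimately show ?thesis using c(2) by (auto simp: children_def)
      qed
      then have "{v \<in> children S u - Domain ?R. msat S v p} = {v \<in> children S c. msat S v p}"
        unfolding uw by blast
      moreover have "children S' c' \<inter> Range ?R = {}"
      proof -
        have "pred S' v \<in> Range R" if "v \<in> Range R" for v using that D(4) by blast
        moreover have "c' \<notin> children S' c'" using level_child[OF S', of c' c'] by auto
        ultimately show ?thesis using c'(2) by (auto simp: children_def)
      qed
      then have "{v \<in> children S' w - Range ?R. msat S' v p} = {v \<in> children S' c'. msat S' v p}"
        unfolding uw by blast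
      moreover have "Dia j p \<in> set ?B"
      proof -
        \<comment> \<open>The basis used at the parent is one height larger than the one used at
          \<open>c\<close>, because \<open>c\<close> still lies below level \<open>d\<close>; so it
          contains \<open>Dia j p\<close>.\<close>
        have e: "d - Suc (level S x) = Suc (d - Suc (level S c))" using lc l uw by simp
        show ?thesis unfolding e using p uw j kq by (intro Dia_in_basis) simp_all
      qed
      ultimately show ?thesis using agree[of "Dia j p"] by simp
    qed
  qed
  then show ?thesis ..
qed

text \<open>Induction along the path from the root: each node on it that is not yet matched costs
  one unit, so \<open>level S x\<close> units suffice.\<close>

lemma partial_match_extend:
  assumes S: "bounded_tree d S" and S': "bounded_tree d S'"
    and R: "partial_match d q k S S' R" and kq: "k \<le> q" and x: "x \<in> carrier S" "level S x \<le> k"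
  shows "\<exists>R' y. R \<subseteq> R' \<and> (x, y) \<in> R' \<and> partial_match d q (k - level S x) S S' R'"
  using x
proof (induction "level S x" arbitrary: x)
  case 0
  have "(pred S ^^ level S x) x = eps S"
    unfolding level_def by (rule LeastI[of _ d]) (use S 0 in \<open>simp add: bounded_tree_def\<close>)
  then have "x = eps S" using 0 by simp
  then show ?case using R 0 partial_matchD(1)[OF R] by auto
next
  case (Suc n)
  have "x \<noteq> eps S"
  proof
    assume "x = eps S"
    then have "level S x = 0" by (simp add: level_def)
    then show False using Suc by simp
  qed
  then have xc: "x \<in> children S (pred S x)" using Suc by (simp add: children_def)
  then have n: "n = level S (pred S x)" using level_child[OF S xc] Suc by simp
  have "pred S x \<in> carrier S" using S Suc by (simp add: bounded_tree_def lt_structure_def)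
  moreover have "level S (pred S x) \<le> k" using n Suc by simp
  ultimately obtain R1 y where R1: "R \<subseteq> R1" "(pred S x, y) \<in> R1" "partial_match d q (k - n) S S' R1"
    using Suc.hyps(1)[OF n] unfolding n[symmetric] by blast
  show ?case
  proof (cases "x \<in> Domain R1")
    case True
    then show ?thesis using R1 partial_match_mono[OF R1(3), of "k - level S x"] Suc by auto
  next
    case False
    have "k - n = Suc (k - level S x)" "k - level S x \<le> q" using Suc kq by simp_all
    then obtain c' where "partial_match d q (k - level S x) S S' (insert (x, c') R1)"
      using partial_match_extend_child[OF S S', of q "k - level S x" R1 "pred S x" y x] R1 xc False kq
      by auto
    then show ?thesis using R1(1) by blast
  qed
qed

lemma partial_match_le:
  assumes S: "bounded_tree d S" and S': "bounded_tree d S'" and R: "partial_match d q k S S' R"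
    and xy: "(x, y) \<in> R" and xy': "(x', y') \<in> R"
  shows "le S x x' \<longleftrightarrow> le S' y y'"
proof -
  note D = partial_matchD[OF R]
  have "x = (pred S ^^ i) x' \<longleftrightarrow> y = (pred S' ^^ i) y'" for i
    using D(5)[OF xy partial_match_pow[OF R xy']] .
  then show ?thesis
    using S S' D(2,3)[OF xy] D(2,3)[OF xy'] by (simp add: bounded_tree_def)
qed

text \<open>Both meets are iterates of \<open>pred\<close>, so each has a partner under
  \<open>R\<close>. A partner is again a common lower bound, so it lies below the meet on its side;
  with both inequalities, antisymmetry identifies the two pairs.\<close>

lemma partial_match_meet:
  assumes S: "bounded_tree d S" and S': "bounded_tree d S'" and R: "partial_match d q k S S' R"
    and xy: "(x, y) \<in> R" and xy': "(x', y') \<in> R"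
  shows "(meet S x x', meet S' y y') \<in> R"
proof -
  note D = partial_matchD[OF R] and le = partial_match_le[OF S S' R]
  have lt: "lt_structure S" "lt_structure S'" using S S' by (auto simp: bounded_tree_def)
  have car: "x \<in> carrier S" "x' \<in> carrier S" "y \<in> carrier S'" "y' \<in> carrier S'"
    using D(2,3) xy xy' by blast+
  have m: "le S (meet S x x') x" "le S (meet S x x') x'"
     "\<And>c. c \<in> carrier S \<Longrightarrow> le S c x \<Longrightarrow> le S c x' \<Longrightarrow> le S c (meet S x x')"
    using S car by (auto simp: bounded_tree_def)
  have m': "le S' (meet S' y y') y" "le S' (meet S' y y') y'"
     "\<And>c. c \<in> carrier S' \<Longrightarrow> le S' c y \<Longrightarrow> le S' c y' \<Longrightarrow> le S' c (meet S' y y')"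
    using S' car by (auto simp: bounded_tree_def)
  have mc: "meet S x x' \<in> carrier S" "meet S' y y' \<in> carrier S'"
    using lt car by (auto simp: lt_structure_def)
  obtain i where "meet S x x' = (pred S ^^ i) x"
    using m(1) S mc car by (auto simp: bounded_tree_def)
  then obtain n where n: "(meet S x x', n) \<in> R" using partial_match_pow[OF R xy, of i] by metis
  obtain j where "meet S' y y' = (pred S' ^^ j) y"
    using m'(1) S' mc car by (auto simp: bounded_tree_def)
  then obtain l where l: "(l, meet S' y y') \<in> R" using partial_match_pow[OF R xy, of j] by metis
  have "le S' n (meet S' y y')"
    using le[OF n xy] le[OF n xy'] m(1,2) m'(3) D(3)[OF n] by blast
  moreover have "le S l (meet S x x')"
    using le[OF l xy] le[OF l xy'] m'(1,2) m(3) D(2)[OF l] by blast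
  then have "le S' (meet S' y y') n" using le[OF l n] by blast
  ultimately have "n = meet S' y y'"
    using bounded_tree_antisym[OF S' D(3)[OF n] mc(2)] by blast
  then show ?thesis using n by simp
qed

lemma partial_match_eval_tm:
  assumes "bounded_tree d S" "bounded_tree d S'" and R: "partial_match d q k S S' R"
    and "\<And>i. (v i, w i) \<in> R"
  shows "(eval_tm S v t, eval_tm S' w t) \<in> R"
  by (induction t) (simp_all add: assms partial_matchD(1,4)[OF R] partial_match_meet[OF assms(1-3)])

fun qrank :: "fm \<Rightarrow> nat" where
  "qrank (FImp p q) = max (qrank p) (qrank q)"
| "qrank (FAll x p) = Suc (qrank p)"
| "qrank _ = 0"

text \<open>A quantifier is answered by matching one node, whose level is at most \<open>d\<close>,
  so \<open>qrank p * d\<close> units pay for all nested quantifiers. Terms cost nothing, as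
  \<open>R\<close> is closed under \<open>pred\<close> and \<open>meet\<close>.\<close>

lemma partial_match_sat:
  assumes S: "bounded_tree d S" and S': "bounded_tree d S'"
  shows "partial_match d q k S S' R \<Longrightarrow> k \<le> q \<Longrightarrow> (\<And>i. (v i, w i) \<in> R) \<Longrightarrow> qrank p * d \<le> k \<Longrightarrow>
    sat S v p = sat S' w p"
proof (induction p arbitrary: k R v w)
  case (FEq t u)
  then show ?case
    using partial_matchD(5)[OF FEq(1)] partial_match_eval_tm[OF S S' FEq(1), of v w] by simp
next
  case (FLe t u)
  then show ?case
    using partial_match_le[OF S S' FLe(1)] partial_match_eval_tm[OF S S' FLe(1), of v w] by simp
next
  case (FImp p1 p2)
  have "qrank p1 * d \<le> qrank (FImp p1 p2) * d" "qrank p2 * d \<le> qrank (FImp p1 p2) * d" by simp_all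
  then have r: "qrank p1 * d \<le> k" "qrank p2 * d \<le> k" using FImp.prems(4) by linarith+
  have "sat S v p1 = sat S' w p1" by (rule FImp.IH(1)[OF FImp.prems(1-3) r(1)])
  moreover have "sat S v p2 = sat S' w p2" by (rule FImp.IH(2)[OF FImp.prems(1-3) r(2)])
  ultimately show ?case by simp
next
  case (FAll x p)
  have k: "d \<le> k" "qrank p * d \<le> k - d" using FAll.prems(4) by simp_all
  have step: "sat S (v(x := a)) p = sat S' (w(x := b)) p"
    if "R \<subseteq> R'" "(a, b) \<in> R'" "partial_match d q (k - d) S S' R'" for R' a b
    by (rule FAll.IH[OF that(3)]) (use that FAll.prems k in auto)
  have fwd: "\<exists>b\<in>carrier S'. sat S (v(x := a)) p = sat S' (w(x := b)) p" if a: "a \<in> carrier S" for a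
  proof -
    have l: "level S a \<le> d" "level S a \<le> k" using level_le[OF S a] k by simp_all
    obtain R' b where R': "R \<subseteq> R'" "(a, b) \<in> R'" "partial_match d q (k - level S a) S S' R'"
      using partial_match_extend[OF S S' FAll.prems(1,2) a l(2)] by blast
    have "partial_match d q (k - d) S S' R'"
      by (rule partial_match_mono[OF R'(3)]) (use l in simp)
    then show ?thesis using step R' partial_matchD(3)[OF R'(3)] by blast
  qed
  have bwd: "\<exists>a\<in>carrier S. sat S (v(x := a)) p = sat S' (w(x := b)) p" if b: "b \<in> carrier S'" for b
  proof -
    have l: "level S' b \<le> d" "level S' b \<le> k" using level_le[OF S' b] k by simp_all
    obtain R' a where R': "R\<inverse> \<subseteq> R'" "(b, a) \<in> R'" "partial_match d q (k - level S' b) S' S R'"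
      using partial_match_extend[OF S' S partial_match_sym[OF FAll.prems(1)] FAll.prems(2) b l(2)] by blast
    have "partial_match d q (k - d) S' S R'"
      by (rule partial_match_mono[OF R'(3)]) (use l in simp)
    then have "partial_match d q (k - d) S S' (R'\<inverse>)" by (rule partial_match_sym)
    moreover have "R \<subseteq> R'\<inverse>" "(a, b) \<in> R'\<inverse>" using R' by auto
    ultimately show ?thesis using step partial_matchD(3)[OF R'(3) R'(2)] by blast
  qed
  show ?case using fwd bwd by (metis sat.simps(5))
qed simp

theorem Th_eq_if_msat_eq:
  assumes S: "bounded_tree d S" and S': "bounded_tree d S'"
    and eq: "\<And>p. msat S (eps S) p = msat S' (eps S') p"
  shows "Th S = Th S'"
proof -
  have lt: "lt_structure S" "lt_structure S'" using S S' by (auto simp: bounded_tree_def)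
  have e: "pred S (eps S) = eps S" "pred S' (eps S') = eps S'" using S S' by (auto simp: bounded_tree_def)
  have "partial_match d q q S S' {(eps S, eps S')}" for q
    unfolding partial_match_def
  proof (intro conjI allI impI ballI)
    fix x y c j
    assume xy: "(x, y) \<in> {(eps S, eps S')}"
    have "{u \<in> children S x - Domain {(eps S, eps S')}. msat S u c} = {u \<in> children S x. msat S u c}"
      "{u \<in> children S' y - Range {(eps S, eps S')}. msat S' u c} = {u \<in> children S' y. msat S' u c}"
      by (auto simp: children_def)
    then show "at_least j {u \<in> children S x - Domain {(eps S, eps S')}. msat S u c} =
       at_least j {u \<in> children S' y - Range {(eps S, eps S')}. msat S' u c}"
      using eq[of "Dia j c"] xy by simp
  qed (use lt e in \<open>auto simp: lt_structure_def\<close>)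
  \<comment> \<open>Cap and starting budget are both \<open>qrank p * d\<close>, chosen for the
    sentence at hand.\<close>
  then have "sat S (\<lambda>_. eps S) p = sat S' (\<lambda>_. eps S') p" for p
    by (rule partial_match_sat[OF S S', of "qrank p * d" "qrank p * d"]) auto
  then show ?thesis by (simp add: Th_eq_sat_eps lt)
qed

section \<open>Realising modal theories by tree plans\<close>

definition mth :: "'a lt_struct \<Rightarrow> 'a \<Rightarrow> mf set" where
  "mth S x = {p. msat S x p}"

lemma mth_eq_iff: "mth S x = mth S' y \<longleftrightarrow> (\<forall>p. msat S x p = msat S' y p)"
  by (auto simp: mth_def)

lemma Gamma_omega_tree_simps [simp]:
  "carrier (Gamma_omega_tree \<Gamma> lam) = Gamma_omega \<Gamma> lam"
  "le (Gamma_omega_tree \<Gamma> lam) = prefix" "eps (Gamma_omega_tree \<Gamma> lam) = []"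
  "meet (Gamma_omega_tree \<Gamma> lam) = longest_common_prefix" "pred (Gamma_omega_tree \<Gamma> lam) = butlast"
  by (auto simp: Gamma_omega_tree_def)

lemma Gamma_omega_take:
  assumes "tree_plan \<Gamma> lam" "s \<in> Gamma_omega \<Gamma> lam"
  shows "take k s \<in> Gamma_omega \<Gamma> lam"
  using assms by (auto simp: Gamma_omega_def tree_plan_def take_map[symmetric] min_def)

lemma bounded_tree_Gamma_omega:
  assumes G: "tree_plan \<Gamma> lam"
  shows "\<exists>d. bounded_tree d (Gamma_omega_tree \<Gamma> lam)"
proof -
  have pre: "s \<in> Gamma_omega \<Gamma> lam" if "prefix s t" "t \<in> Gamma_omega \<Gamma> lam" for s t
    using Gamma_omega_take[OF G that(2), of "length s"] that(1) by (auto simp: prefix_def)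
  have pow: "prefix s t \<longleftrightarrow> (\<exists>i. s = (butlast ^^ i) t)" for s t :: "(nat \<times> nat option) list"
  proof
    assume "prefix s t"
    then have "s = (butlast ^^ (length t - length s)) t" by (auto simp: butlast_power prefix_def)
    then show "\<exists>i. s = (butlast ^^ i) t" ..
  qed (auto simp: butlast_power take_is_prefix)
  have len: "length s \<le> Max (length ` \<Gamma>)" if "s \<in> Gamma_omega \<Gamma> lam" for s
  proof -
    have "length (map fst s) \<in> length ` \<Gamma>"
      using that unfolding Gamma_omega_def by blast
    then show ?thesis using G by (auto simp: tree_plan_def intro!: Max_ge)
  qed
  have "bounded_tree (Max (length ` \<Gamma>)) (Gamma_omega_tree \<Gamma> lam)"
    unfolding bounded_tree_def lt_structure_def Gamma_omega_tree_simps
  proof (intro conjI ballI impI)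
    show "[] \<in> Gamma_omega \<Gamma> lam" using G by (auto simp: Gamma_omega_def tree_plan_def)
    fix s assume s: "s \<in> Gamma_omega \<Gamma> lam"
    show "butlast s \<in> Gamma_omega \<Gamma> lam" using pre[OF _ s] prefixeq_butlast by blast
    show "(butlast ^^ Max (length ` \<Gamma>)) s = []" using len[OF s] by (simp add: butlast_power)
    fix t
    show "prefix s t \<longleftrightarrow> (\<exists>i. s = (butlast ^^ i) t)" by (rule pow)
    show "longest_common_prefix s t \<in> Gamma_omega \<Gamma> lam"
      using pre[OF longest_common_prefix_prefix1 s] .
    show "prefix (longest_common_prefix s t) s" "prefix (longest_common_prefix s t) t"
      by (simp_all add: longest_common_prefix_prefix1 longest_common_prefix_prefix2)
    show "prefix c (longest_common_prefix s t)" if "prefix c s \<and> prefix c t" for c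
      using that longest_common_prefix_max_prefix by blast
  qed simp
  then show ?thesis ..
qed

section \<open>Joining plans at a new root\<close>

definition plan_join :: "nat \<Rightarrow> (nat \<Rightarrow> nat list set) \<Rightarrow> nat list set" where
  "plan_join r G = insert [] (\<Union>i<r. (#) i ` G i)"

text \<open>The node \<open>[i]\<close> is the root of branch \<open>i\<close>. A plan has
  multiplicity \<open>One\<close> at its root, so \<open>\<mu> i\<close> must override
  \<open>L i []\<close> there.\<close>

definition mult_join :: "(nat \<Rightarrow> mult) \<Rightarrow> (nat \<Rightarrow> nat list \<Rightarrow> mult) \<Rightarrow> nat list \<Rightarrow> mult" where
  "mult_join \<mu> L s = (case s of [] \<Rightarrow> One | i # t \<Rightarrow> if t = [] then \<mu> i else L i t)"

lemma tree_plan_join: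
  assumes "\<And>i. i < r \<Longrightarrow> tree_plan (G i) (L i)"
  shows "tree_plan (plan_join r G) (mult_join \<mu> L)"
  unfolding tree_plan_def
proof (intro conjI ballI allI)
  show "finite (plan_join r G)" using assms by (auto simp: plan_join_def tree_plan_def)
  fix s k assume s: "s \<in> plan_join r G"
  show "take k s \<in> plan_join r G"
  proof (cases "k = 0 \<or> s = []")
    case False
    then obtain j i t where k: "k = Suc j" and t: "s = i # t" "i < r" "t \<in> G i"
      using s by (cases k) (auto simp: plan_join_def)
    then have "take j t \<in> G i" using assms by (auto simp: tree_plan_def)
    then show ?thesis using t k by (auto simp: plan_join_def)
  qed (auto simp: plan_join_def)
qed (auto simp: plan_join_def mult_join_def)

definition copy_index :: "mult \<Rightarrow> nat option \<Rightarrow> bool" where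
  "copy_index m t \<longleftrightarrow> (t = None \<longleftrightarrow> m = One)"

lemma Gamma_omega_join_Cons:
  assumes "\<And>i. i < r \<Longrightarrow> tree_plan (G i) (L i)"
  shows "(i, t) # s \<in> Gamma_omega (plan_join r G) (mult_join \<mu> L) \<longleftrightarrow>
    i < r \<and> copy_index (\<mu> i) t \<and> s \<in> Gamma_omega (G i) (L i)"
proof -
  have "(mult_join \<mu> L) (take (Suc (Suc k)) (i # map fst s)) = L i (take (Suc k) (map fst s))"
    if "k < length s" for k
    using that by (cases s) (auto simp: mult_join_def)
  moreover have "mult_join \<mu> L [i] = \<mu> i" by (simp add: mult_join_def)
  ultimately show ?thesis
    by (cases "\<mu> i") (auto simp: Gamma_omega_def plan_join_def copy_index_def All_less_Suc2)
qed

lemma Nil_in_Gamma_omega: "tree_plan \<Gamma> lam \<Longrightarrow> [] \<in> Gamma_omega \<Gamma> lam"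
  by (auto simp: Gamma_omega_def tree_plan_def)

text \<open>Prefixing \<open>(i, t)\<close> embeds the tree of plan \<open>i\<close> as the full
  subtree above \<open>[(i, t)]\<close>, for every admissible copy \<open>t\<close>.\<close>

lemma msat_join_Cons:
  fixes r G L \<mu>
  defines "T \<equiv> Gamma_omega_tree (plan_join r G) (mult_join \<mu> L)"
  assumes plans: "\<And>i. i < r \<Longrightarrow> tree_plan (G i) (L i)" and i: "i < r" "copy_index (\<mu> i) t"
  shows "msat T [(i, t)] p = msat (Gamma_omega_tree (G i) (L i)) [] p"
proof (rule msat_map[where h = "(#) (i, t)" and D = "Gamma_omega (G i) (L i)"])
  fix s assume s: "s \<in> Gamma_omega (G i) (L i)"
  have "(i, t) # c \<in> children T ((i, t) # s) \<longleftrightarrow> c \<in> children (Gamma_omega_tree (G i) (L i)) s" for c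
    using i by (auto simp: children_def T_def Gamma_omega_join_Cons[OF plans])
  moreover have "\<exists>c. v = (i, t) # c" if "v \<in> children T ((i, t) # s)" for v
    using that by (cases v) (auto simp: children_def T_def split: if_splits)
  ultimately show "bij_betw ((#) (i, t)) (children (Gamma_omega_tree (G i) (L i)) s) (children T ((i, t) # s))"
    unfolding bij_betw_def by (auto simp: image_iff) blast
  show "children (Gamma_omega_tree (G i) (L i)) s \<subseteq> Gamma_omega (G i) (L i)"
    by (auto simp: children_def)
qed (use plans i Nil_in_Gamma_omega in auto)

lemma children_join_Nil:
  assumes plans: "\<And>i. i < r \<Longrightarrow> tree_plan (G i) (L i)"
  shows "children (Gamma_omega_tree (plan_join r G) (mult_join \<mu> L)) [] =
    {[(i, t)] |i t. i < r \<and> copy_index (\<mu> i) t}"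
proof -
  have "v \<in> children (Gamma_omega_tree (plan_join r G) (mult_join \<mu> L)) [] \<longleftrightarrow>
    (\<exists>i t. v = [(i, t)] \<and> i < r \<and> copy_index (\<mu> i) t)" for v
  proof (cases v)
    case (Cons a w)
    obtain i t where a: "a = (i, t)" by (cases a)
    show ?thesis
      using Nil_in_Gamma_omega[OF plans]
      by (auto simp: Cons a children_def Gamma_omega_join_Cons[OF plans] split: if_splits)
  qed (auto simp: children_def)
  then show ?thesis by blast
qed

text \<open>If an infinite class of children satisfies \<open>p\<close>, its representative has
  multiplicity \<open>Infty\<close> and both counts are infinite. Otherwise every child satisfying
  \<open>p\<close> lies in a finite class, hence belongs to \<open>E\<close> and appears exactly
  once, so the counts agree.\<close>

lemma msat_join_eq:
  fixes r G L \<mu>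
  defines "T \<equiv> Gamma_omega_tree (plan_join r G) (mult_join \<mu> L)"
  assumes fin: "finite (mth M ` children M x)"
    and g: "bij_betw g {..<r} E"
    and E: "E = (\<Union>m\<in>mth M ` children M x.
       if finite {c \<in> children M x. mth M c = m} then {c \<in> children M x. mth M c = m}
       else {SOME c. c \<in> children M x \<and> mth M c = m})"
    and \<mu>: "\<And>i. \<mu> i = (if finite {c \<in> children M x. mth M c = mth M (g i)} then One else Infty)"
    and plans: "\<And>i. i < r \<Longrightarrow> tree_plan (G i) (L i)"
    and sat: "\<And>i p. i < r \<Longrightarrow> msat (Gamma_omega_tree (G i) (L i)) [] p = msat M (g i) p"
  shows "msat T [] p = msat M x p"
proof (induction p)
  case (Dia n p)
  let ?X = "{c \<in> children M x. msat M c p}" and ?Y = "{v \<in> children T []. msat T v p}"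
  have some: "(SOME c. c \<in> children M x \<and> mth M c = m) \<in> children M x \<and>
      mth M (SOME c. c \<in> children M x \<and> mth M c = m) = m" if "m \<in> mth M ` children M x" for m
    by (rule someI_ex) (use that in auto)
  have EM: "E \<subseteq> children M x" unfolding E using some by (auto split: if_splits)
  have gE: "g i \<in> E" if "i < r" for i using g that by (auto simp: bij_betw_def)
  have Y: "?Y = {[(i, t)] |i t. i < r \<and> copy_index (\<mu> i) t \<and> msat M (g i) p}"
  proof -
    have "msat T [(i, t)] p = msat M (g i) p" if "i < r" "copy_index (\<mu> i) t" for i t
      using msat_join_Cons[where r = r and G = G and L = L and \<mu> = \<mu> and i = i and t = t and p = p]
        plans that sat[OF that(1)] by (simp add: T_def)
    moreover have "children T [] = {[(i, t)] |i t. i < r \<and> copy_index (\<mu> i) t}"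
      unfolding T_def by (rule children_join_Nil[OF plans])
    ultimately show ?thesis by auto
  qed
  show ?case
  proof (cases "\<exists>c\<in>?X. infinite {c' \<in> children M x. mth M c' = mth M c}")
    case True
    then obtain c where c: "c \<in> ?X" and inf: "infinite {c' \<in> children M x. mth M c' = mth M c}" by blast
    have "{c' \<in> children M x. mth M c' = mth M c} \<subseteq> ?X" using c by (auto simp: mth_eq_iff)
    then have X: "infinite ?X" using inf finite_subset by blast
    let ?e = "SOME c'. c' \<in> children M x \<and> mth M c' = mth M c"
    have "mth M c \<in> mth M ` children M x" using c by auto
    then have e: "mth M ?e = mth M c" "?e \<in> E" using some inf unfolding E by auto
    then obtain i where i: "i < r" "g i = ?e" using g by (auto simp: bij_betw_def)
    have "\<mu> i = Infty" using inf by (simp add: \<mu> i e)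
    moreover have "msat M (g i) p" using e c i by (simp add: mth_eq_iff)
    ultimately have "range (\<lambda>k. [(i, Some k)]) \<subseteq> ?Y" using i by (auto simp: Y copy_index_def)
    moreover have "infinite (range (\<lambda>k :: nat. [(i, Some k)]))"
      by (rule range_inj_infinite) (auto simp: inj_on_def)
    ultimately have "infinite ?Y" using finite_subset by blast
    then show ?thesis using X by (simp add: at_least_iff)
  next
    case False
    then have fc: "finite {c' \<in> children M x. mth M c' = mth M c}" if "c \<in> ?X" for c using that by blast
    have XE: "?X \<subseteq> E"
    proof
      fix c assume c: "c \<in> ?X"
      then have "mth M c \<in> mth M ` children M x" by auto
      then show "c \<in> E" unfolding E using fc[OF c] c by (intro UN_I) auto
    qed
    let ?I = "{i. i < r \<and> g i \<in> ?X}"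
    have "bij_betw g ?I ?X"
      using g XE unfolding bij_betw_def by (auto simp: inj_on_def image_iff subset_iff)
    then have "at_least n ?I = at_least n ?X" by (rule at_least_bij)
    moreover have "bij_betw (\<lambda>i. [(i, None)]) ?I ?Y"
    proof -
      have one: "\<mu> i = One" if "i < r" "msat M (g i) p" for i
        using fc[of "g i"] gE[OF that(1)] EM that by (auto simp: \<mu>)
      show ?thesis
        unfolding bij_betw_def Y using gE EM one by (auto simp: inj_on_def copy_index_def image_iff)
    qed
    then have "at_least n ?I = at_least n ?Y" by (rule at_least_bij)
    ultimately show ?thesis by simp
  qed
qed auto

lemma exists_tree_plan:
  assumes M: "bounded_tree d M" and fin: "\<And>x. x \<in> carrier M \<Longrightarrow> finite (mth M ` children M x)"
    and x: "x \<in> carrier M"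
  shows "\<exists>\<Gamma> lam. tree_plan \<Gamma> lam \<and> (\<forall>p. msat (Gamma_omega_tree \<Gamma> lam) [] p = msat M x p)"
  using x
\<comment> \<open>The measure is the height still available above \<open>x\<close>, so the plans of
  the children exist already and are joined at a new root.\<close>
proof (induction "d - level M x" arbitrary: x rule: less_induct)
  case less
  have "\<exists>\<Gamma> lam. tree_plan \<Gamma> lam \<and> (\<forall>p. msat (Gamma_omega_tree \<Gamma> lam) [] p = msat M c p)"
    if c: "c \<in> children M x" for c
  proof -
    have cM: "c \<in> carrier M" using c by (simp add: children_def)
    show ?thesis
      by (rule less(1)) (use level_child[OF M c] level_le[OF M cM] cM in auto)
  qed
  then obtain G L where GL: "\<And>c. c \<in> children M x \<Longrightarrow>
      tree_plan (G c) (L c) \<and> (\<forall>p. msat (Gamma_omega_tree (G c) (L c)) [] p = msat M c p)"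
    by metis
  define cl where "cl m = {c \<in> children M x. mth M c = m}" for m
  define E where "E = (\<Union>m\<in>mth M ` children M x. if finite (cl m) then cl m
       else {SOME c. c \<in> children M x \<and> mth M c = m})"
  \<comment> \<open>Finitely many theories occur, and each contributes a finite set: its whole class
    or one representative.\<close>
  have "finite E" using fin[OF less(2)] by (auto simp: E_def)
  then obtain g where g: "bij_betw g {..<card E} E"
    using ex_bij_betw_nat_finite by (metis atLeast0LessThan)
  have "E \<subseteq> children M x"
  proof
    fix c assume "c \<in> E"
    then obtain m where m: "m \<in> mth M ` children M x"
       "c \<in> (if finite (cl m) then cl m else {SOME c. c \<in> children M x \<and> mth M c = m})"
      unfolding E_def by blast
    have "(SOME c. c \<in> children M x \<and> mth M c = m) \<in> children M x \<and>
      mth M (SOME c. c \<in> children M x \<and> mth M c = m) = m"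
      by (rule someI_ex) (use m in auto)
    then show "c \<in> children M x" using m(2) by (auto simp: cl_def split: if_splits)
  qed
  then have gc: "g i \<in> children M x" if "i < card E" for i
    using g that by (auto simp: bij_betw_def)
  let ?\<mu> = "\<lambda>i. if finite {c \<in> children M x. mth M c = mth M (g i)} then One else Infty"
  let ?G = "plan_join (card E) (G \<circ> g)" and ?L = "mult_join ?\<mu> (L \<circ> g)"
  have "tree_plan ?G ?L" by (rule tree_plan_join) (use GL gc in auto)
  moreover have "msat (Gamma_omega_tree ?G ?L) [] p = msat M x p" for p
    by (rule msat_join_eq[where E = E and g = g])
      (use fin[OF less(2)] g GL gc in \<open>auto simp: E_def cl_def\<close>)
  ultimately show ?case by blast
qed

section \<open>Consequences of categoricity\<close>

lemma is_treeD:
  assumes "is_tree M"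
  shows "lt_structure M" "pred M (eps M) = eps M"
    "\<And>a. a \<in> carrier M \<Longrightarrow> le M a a"
    "\<And>a b. a \<in> carrier M \<Longrightarrow> b \<in> carrier M \<Longrightarrow> le M a b \<Longrightarrow> le M b a \<Longrightarrow> a = b"
    "\<And>a b c. a \<in> carrier M \<Longrightarrow> b \<in> carrier M \<Longrightarrow> c \<in> carrier M \<Longrightarrow> le M a b \<Longrightarrow> le M b c \<Longrightarrow> le M a c"
    "\<And>b X. b \<in> carrier M \<Longrightarrow> X \<subseteq> {a \<in> carrier M. le M a b} \<Longrightarrow> X \<noteq> {} \<Longrightarrow> \<exists>m\<in>X. \<forall>x\<in>X. le M m x"
    "\<And>a. a \<in> carrier M \<Longrightarrow> le M (eps M) a"
    "\<And>a b. a \<in> carrier M \<Longrightarrow> b \<in> carrier M \<Longrightarrow> le M (meet M a b) a \<and> le M (meet M a b) b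
        \<and> (\<forall>c\<in>carrier M. le M c a \<and> le M c b \<longrightarrow> le M c (meet M a b))"
    "\<And>a. a \<in> carrier M \<Longrightarrow> a \<noteq> eps M \<Longrightarrow> le M (pred M a) a \<and> pred M a \<noteq> a"
    "\<And>a c. a \<in> carrier M \<Longrightarrow> a \<noteq> eps M \<Longrightarrow> c \<in> carrier M \<Longrightarrow> le M c a \<Longrightarrow> c \<noteq> a \<Longrightarrow> le M c (pred M a)"
proof -
  let ?C = "carrier M"
  have 1: "lt_structure M" and 2: "pred M (eps M) = eps M" and 3: "\<forall>a\<in>?C. le M a a"
    and 4: "\<forall>a\<in>?C. \<forall>b\<in>?C. le M a b \<and> le M b a \<longrightarrow> a = b"
    and 5: "\<forall>a\<in>?C. \<forall>b\<in>?C. \<forall>c\<in>?C. le M a b \<and> le M b c \<longrightarrow> le M a c"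
    and 6: "\<forall>b\<in>?C. (\<forall>a1\<in>?C. \<forall>a2\<in>?C. le M a1 b \<and> le M a2 b \<longrightarrow> le M a1 a2 \<or> le M a2 a1)
      \<and> (\<forall>X. X \<subseteq> {a \<in> ?C. le M a b} \<and> X \<noteq> {} \<longrightarrow> (\<exists>m\<in>X. \<forall>x\<in>X. le M m x))"
    and 7: "\<forall>a\<in>?C. le M (eps M) a"
    and 8: "\<forall>a\<in>?C. \<forall>b\<in>?C. le M (meet M a b) a \<and> le M (meet M a b) b
        \<and> (\<forall>c\<in>?C. le M c a \<and> le M c b \<longrightarrow> le M c (meet M a b))"
    and 9: "\<forall>a\<in>?C. a \<noteq> eps M \<longrightarrow> (le M (pred M a) a \<and> pred M a \<noteq> a
        \<and> (\<forall>c\<in>?C. le M c a \<and> c \<noteq> a \<longrightarrow> le M c (pred M a)))"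
    using assms unfolding is_tree_def by - (elim conjE, assumption)+
  show "lt_structure M" by (rule 1)
  show "pred M (eps M) = eps M" by (rule 2)
  show "le M a a" if "a \<in> ?C" for a using 3 that by blast
  show "a = b" if "a \<in> ?C" "b \<in> ?C" "le M a b" "le M b a" for a b using 4 that by blast
  show "le M a c" if "a \<in> ?C" "b \<in> ?C" "c \<in> ?C" "le M a b" "le M b c" for a b c using 5 that by blast
  show "\<exists>m\<in>X. \<forall>x\<in>X. le M m x" if "b \<in> ?C" "X \<subseteq> {a \<in> ?C. le M a b}" "X \<noteq> {}" for b X
    using 6[THEN bspec, OF that(1), THEN conjunct2, THEN spec, of X] that by blast
  show "le M (eps M) a" if "a \<in> ?C" for a using 7 that by blast
  show "le M (meet M a b) a \<and> le M (meet M a b) b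
      \<and> (\<forall>c\<in>?C. le M c a \<and> le M c b \<longrightarrow> le M c (meet M a b))" if "a \<in> ?C" "b \<in> ?C" for a b
    using 8 that by blast
  show "le M (pred M a) a \<and> pred M a \<noteq> a" if "a \<in> ?C" "a \<noteq> eps M" for a using 9 that by blast
  show "le M c (pred M a)" if "a \<in> ?C" "a \<noteq> eps M" "c \<in> ?C" "le M c a" "c \<noteq> a" for a c
    using 9 that by blast
qed

text \<open>A node at infinite height would make the least such node below it a limit, without
  a predecessor.\<close>
lemma tree_height_finite:
  assumes M: "is_tree M" and b: "b \<in> carrier M"
  shows "\<exists>n. (pred M ^^ n) b = eps M"
proof (rule ccontr)
  assume nb: "\<not> ?thesis"
  note T = is_treeD[OF M]
  let ?X = "{a \<in> carrier M. le M a b \<and> (\<forall>n. (pred M ^^ n) a \<noteq> eps M)}"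
  have "b \<in> ?X" using b nb T(3) by blast
  then obtain m where m: "m \<in> ?X" "\<forall>x\<in>?X. le M m x" using T(6)[OF b, of ?X] by blast
  have "(pred M ^^ 0) m \<noteq> eps M" using m by blast
  then have me: "m \<noteq> eps M" by simp
  have pc: "pred M m \<in> carrier M" using T(1) m by (auto simp: lt_structure_def)
  have pm: "le M (pred M m) m" "pred M m \<noteq> m" using T(9)[of m] m me by auto
  have "(pred M ^^ n) (pred M m) \<noteq> eps M" for n
  proof -
    have "(pred M ^^ Suc n) m \<noteq> eps M" using m by blast
    then show ?thesis by (simp add: funpow_swap1)
  qed
  moreover have "le M (pred M m) b" using T(5)[OF pc _ b pm(1)] m by blast
  ultimately have "le M m (pred M m)" using m(2) pc by blast
  then show False using T(4)[OF pc] pm m by blast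
qed

text \<open>An element strictly below \<open>y\<close> is below \<open>pred M y\<close>; since the
  descent from \<open>y\<close> reaches the root after finitely many steps, it passes through
  \<open>x\<close>.\<close>

lemma tree_le_iff:
  assumes M: "is_tree M" and xy: "x \<in> carrier M" "y \<in> carrier M"
  shows "le M x y \<longleftrightarrow> (\<exists>i. x = (pred M ^^ i) y)"
proof
  note T = is_treeD[OF M]
  obtain n where "(pred M ^^ n) y = eps M" using tree_height_finite[OF M xy(2)] ..
  then show "\<exists>i. x = (pred M ^^ i) y" if "le M x y"
    using that xy(2)
  proof (induction n arbitrary: y)
    case 0
    then have "x = eps M" using T(4)[OF xy(1), of y] T(7)[OF xy(1)] by simp
    then show ?case using 0 by (intro exI[of _ 0]) simp
  next
    case (Suc n)
    show ?case
    proof (cases "x = y \<or> y = eps M")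
      case True
      then have "x = y" using T(4)[OF xy(1), of y] T(7)[OF xy(1)] Suc by auto
      then show ?thesis by (intro exI[of _ 0]) simp
    next
      case False
      have "pred M y \<in> carrier M" using T(1) Suc by (auto simp: lt_structure_def)
      then obtain i where "x = (pred M ^^ i) (pred M y)"
        using Suc.IH[of "pred M y"] Suc.prems T(10)[of y x] False xy(1) by (auto simp: funpow_swap1)
      then show ?thesis by (intro exI[of _ "Suc i"]) (simp add: funpow_swap1)
    qed
  qed
  have "le M ((pred M ^^ i) y) y" for i
  proof (induction i)
    case (Suc i)
    let ?z = "(pred M ^^ i) y"
    have z: "?z \<in> carrier M" "pred M ?z \<in> carrier M"
      using pred_pow_closed[OF T(1) xy(2), of i] pred_pow_closed[OF T(1) xy(2), of "Suc i"] by simp_all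
    have "le M (pred M ?z) ?z" using T(2,3,9) z by (cases "?z = eps M") auto
    then show ?case using T(5)[OF z(2,1) xy(2)] Suc by simp
  qed (use T(3) xy in simp)
  then show "le M x y" if "\<exists>i. x = (pred M ^^ i) y" using that by blast
qed

lemma bounded_tree_if_tree:
  assumes M: "is_tree M" and d: "\<And>x. x \<in> carrier M \<Longrightarrow> (pred M ^^ d) x = eps M"
  shows "bounded_tree d M"
  using is_treeD(1,2,8)[OF M] d tree_le_iff[OF M] by (simp add: bounded_tree_def)

section \<open>Bounded height from categoricity\<close>

lemma iso_map_pred_pow:
  assumes "iso_map f S S'" "lt_structure S" "x \<in> carrier S"
  shows "f ((pred S ^^ n) x) = (pred S' ^^ n) (f x)"
  by (induction n) (use assms pred_pow_closed[OF assms(2,3)] in \<open>auto simp: iso_map_def\<close>)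

lemma (in ultrapower) ev_pred_pow:
  assumes "f \<in> carrier upow"
  shows "eventually (\<lambda>k. (pred upow ^^ n) f k = (pred S ^^ n) (f k)) U"
proof (induction n)
  case (Suc n)
  with ev_pred[OF pred_pow_closed[OF upow_structure assms, of n]] show ?case by eventually_elim simp
qed simp

lemma (in ultrapower) infinite_upow:
  assumes "infinite (carrier S)"
  shows "infinite (carrier upow)"
proof -
  have "inj_on (\<lambda>a. rep (\<lambda>_. a)) (carrier S)"
  proof (rule inj_onI)
    fix a b assume a: "a \<in> carrier S" "b \<in> carrier S" "rep (\<lambda>_. a) = rep (\<lambda>_. b)"
    have "eventually (\<lambda>k. a = b) U"
      using rep(2)[of "\<lambda>_. a"] rep(2)[of "\<lambda>_. b"] a by (auto elim: eventually_elim2)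
    then show "a = b" using proper by (cases "a = b") (auto simp: trivial_limit_def)
  qed
  moreover have "(\<lambda>a. rep (\<lambda>_. a)) ` carrier S \<subseteq> carrier upow" by auto
  ultimately show ?thesis using assms finite_subset finite_imageD by blast
qed

lemma (in ultrapower) ev_cofinite: "finite {k. \<not> P k} \<Longrightarrow> eventually P U"
  using free by (simp add: le_filter_def eventually_cofinite)

text \<open>Nodes of \<open>M\<close> have finite height, and so have those of its countable
  submodel. The submodel of the ultrapower is chosen to contain the class of a sequence of nodes of
  growing height; an isomorphism would give this class some finite height \<open>n\<close>.\<close>

lemma categorical_height_bounded:
  assumes M: "is_tree M" and inf: "infinite (carrier M)" and cat: "aleph0_categorical M"
  shows "\<exists>d. bounded_tree d M"
proof (rule ccontr)
  assume unb: "\<not> ?thesis"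
  note T = is_treeD[OF M]
  have "\<exists>x\<in>carrier M. (pred M ^^ d) x \<noteq> eps M" for d
    using unb bounded_tree_if_tree[OF M, of d] by blast
  then obtain b where b: "\<And>d. b d \<in> carrier M" "\<And>d. (pred M ^^ d) (b d) \<noteq> eps M" by metis
  have b': "(pred M ^^ n) (b k) \<noteq> eps M" if "n \<le> k" for n k
  proof
    assume e: "(pred M ^^ n) (b k) = eps M"
    have "(pred M ^^ k) (b k) = (pred M ^^ (k - n)) ((pred M ^^ n) (b k))"
      using that by (simp flip: funpow_add comp_apply[of "pred M ^^ _" "pred M ^^ _"])
    then show False using b(2)[of k] e pred_pow_eps[OF T(2)] by simp
  qed
  obtain U :: "nat filter" where "ultrapower U M"
    using exists_free_ultrafilter T(1) by (auto simp: ultrapower_def)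
  then interpret ultrapower U M .
  obtain C where C: "countable C" "C \<subseteq> carrier M" "infinite C" "lt_structure (M\<lparr>carrier := C\<rparr>)"
    "Th (M\<lparr>carrier := C\<rparr>) = Th M"
    by (rule loewenheim_skolem[OF T(1) countable_empty empty_subsetI inf]) (rule that)
  let ?b = "rep b"
  have bU: "?b \<in> carrier upow" using b by simp
  have bU': "countable {?b}" "{?b} \<subseteq> carrier upow" using bU by auto
  obtain C' where C': "countable C'" "{?b} \<subseteq> C'" "infinite C'" "lt_structure (upow\<lparr>carrier := C'\<rparr>)"
    "Th (upow\<lparr>carrier := C'\<rparr>) = Th upow" "C' \<subseteq> carrier upow"
    by (rule loewenheim_skolem[OF upow_structure bU' infinite_upow[OF inf]]) (rule that)
  have "lt_iso (M\<lparr>carrier := C\<rparr>) (upow\<lparr>carrier := C'\<rparr>)"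
    by (rule aleph0_categorical_lt_iso[OF cat]) (use C C' Th_upow in auto)
  then obtain f where f: "iso_map f (M\<lparr>carrier := C\<rparr>) (upow\<lparr>carrier := C'\<rparr>)"
    unfolding lt_iso_iff by blast
  then obtain x where x: "x \<in> C" "f x = ?b"
    using C'(2) by (auto simp: iso_map_def bij_betw_def)
  obtain n where n: "(pred M ^^ n) x = eps M" using tree_height_finite[OF M] x C by blast
  have "eventually (\<lambda>k. (pred upow ^^ n) ?b k = eps upow k) U"
    using iso_map_pred_pow[OF f C(4), of x n] x n f by (simp add: iso_map_def)
  moreover have "eventually (\<lambda>k. (pred upow ^^ n) ?b k = (pred M ^^ n) (?b k)) U"
    by (rule ev_pred_pow[OF bU])
  moreover have "eventually (\<lambda>k. ?b k = b k) U" by (rule rep(2)[OF b(1)])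
  \<comment> \<open>Freeness enters here: the coordinates below \<open>n\<close> are negligible, and
    at the others \<open>n\<close> steps down from \<open>b k\<close> do not reach the root.\<close>
  moreover have "eventually (\<lambda>k. n \<le> k) U" by (rule ev_cofinite) (simp add: not_le)
  ultimately have "eventually (\<lambda>k. False) U"
    using ev_eps by eventually_elim (use b' in simp)
  then show False using proper by (simp add: trivial_limit_def)
qed

section \<open>Limit theories and pruning\<close>

text \<open>Node \<open>x\<close> is a limit of the complete modal theory \<open>P\<close> if each formula of \<open>P\<close> holds in some
  child of \<open>x\<close> not realising \<open>P\<close>; that makes the number of children realising \<open>P\<close> itself invisible.\<close>
definition limit_node :: "'a lt_struct \<Rightarrow> mf set \<Rightarrow> 'a \<Rightarrow> bool" where
  "limit_node S P x \<longleftrightarrow> (\<forall>p\<in>P. \<exists>q\<in>P. msat S x (Dia (Suc 0) (MAnd p (MNot q))))"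

text \<open>The definition is phrased by modal formulas at \<open>x\<close>, so it transfers
  wherever \<open>msat\<close> does; this form, with actual children, serves the counting.\<close>

lemma limit_node_iff:
  "limit_node S P x \<longleftrightarrow> (\<forall>p\<in>P. \<exists>q\<in>P. \<exists>c\<in>children S x. msat S c p \<and> \<not> msat S c q)"
  by (simp add: limit_node_def at_least_1) blast

text \<open>A formula on which two nodes differ can be replaced by its negation, so the difference
  can be put on the side of \<open>b\<close>.\<close>

lemma mth_neq: "mth S c \<noteq> mth S' b \<Longrightarrow> \<exists>q\<in>mth S' b. \<not> msat S c q"
proof -
  assume "mth S c \<noteq> mth S' b"
  then obtain q where q: "msat S c q \<noteq> msat S' b q" by (auto simp: mth_eq_iff)
  then show ?thesis
    by (intro bexI[of _ "if msat S' b q then q else MNot q"]) (auto simp: mth_def)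
qed

text \<open>Otherwise each of the finitely many children counted falsifies some formula of
  \<open>mth S' b\<close>. Conjoining these with \<open>p\<close> gives a formula of
  \<open>mth S' b\<close> true at none of them, against the limit property.\<close>

lemma limit_node_infinite:
  assumes x: "limit_node S (mth S' b) x" and p: "p \<in> mth S' b"
  shows "infinite {c \<in> children S x. msat S c p \<and> mth S c \<noteq> mth S' b}"
proof
  assume fin: "finite {c \<in> children S x. msat S c p \<and> mth S c \<noteq> mth S' b}" (is "finite ?Z")
  have "\<exists>p'\<in>mth S' b. \<forall>c. msat S c p' \<longrightarrow> msat S c p \<and> c \<notin> Z"
    if "finite Z" "Z \<subseteq> ?Z" for Z
    using that
  proof (induction Z)
    case (insert z Z)
    then obtain p' where p': "p' \<in> mth S' b" "\<forall>c. msat S c p' \<longrightarrow> msat S c p \<and> c \<notin> Z" by auto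
    obtain q where "q \<in> mth S' b" "\<not> msat S z q" using mth_neq[of S z S' b] insert by auto
    then show ?case using p' by (intro bexI[of _ "MAnd p' q"]) (auto simp: mth_def)
  qed (use p in auto)
  from this[OF fin] obtain p' where p': "p' \<in> mth S' b" "\<forall>c. msat S c p' \<longrightarrow> msat S c p \<and> c \<notin> ?Z"
    by auto
  then obtain q c where "q \<in> mth S' b" "c \<in> children S x" "msat S c p'" "\<not> msat S c q"
    using x unfolding limit_node_iff by blast
  then show False using p' by (auto simp: mth_def)
qed

definition limit_child :: "'a lt_struct \<Rightarrow> mf set \<Rightarrow> 'a \<Rightarrow> bool" where
  "limit_child M P c \<longleftrightarrow> c \<noteq> eps M \<and> mth M c = P \<and> limit_node M P (pred M c)"

text \<open>Index \<open>0\<close> tests the node itself, the others its ancestors. Whole subtrees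
  disappear, so what remains is closed under \<open>pred\<close> and, with the order given by
  iterates of \<open>pred\<close>, under \<open>meet\<close>.\<close>

definition omitting :: "'a lt_struct \<Rightarrow> mf set \<Rightarrow> 'a set" where
  "omitting M P = {x \<in> carrier M. \<forall>i. \<not> limit_child M P ((pred M ^^ i) x)}"

lemma omitting_not_limit_child:
  assumes "x \<in> omitting M P"
  shows "\<not> limit_child M P x"
proof -
  have "\<not> limit_child M P ((pred M ^^ 0) x)" using assms unfolding omitting_def by blast
  then show ?thesis by simp
qed

text \<open>\<open>P\<close> may come from another structure because the application reads it off an
  ultrapower. At a remaining limit node and for \<open>p \<in> P\<close>, the children satisfying
  \<open>p\<close> are infinite in number before and after. If \<open>p \<notin> P\<close>, no
  removed child satisfies \<open>p\<close>; at a remaining node that is no limit, no child is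
  removed.\<close>

lemma
  assumes M: "bounded_tree d M" and P: "P = mth S' b"
  defines "N \<equiv> M\<lparr>carrier := omitting M P\<rparr>"
  shows omitting_msat: "\<And>x p. x \<in> omitting M P \<Longrightarrow> msat N x p = msat M x p"
    and omitting_bounded_tree: "bounded_tree d N"
    and omitting_Th: "Th N = Th M"
    and omitting_infinite: "infinite (carrier M) \<Longrightarrow> infinite (omitting M P)"
proof -
  let ?D = "omitting M P"
  have lt: "lt_structure M" and e: "pred M (eps M) = eps M" using M by (auto simp: bounded_tree_def)
  have DM: "?D \<subseteq> carrier M" by (auto simp: omitting_def)
  have eD: "eps M \<in> ?D"
    using lt by (auto simp: omitting_def limit_child_def pred_pow_eps[OF e] lt_structure_def)
  have pD: "pred M x \<in> ?D" if "x \<in> ?D" for x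
  proof -
    have "\<not> limit_child M P ((pred M ^^ i) (pred M x))" for i
    proof -
      have "\<not> limit_child M P ((pred M ^^ Suc i) x)" using that unfolding omitting_def by blast
      then show ?thesis by (simp add: funpow_swap1)
    qed
    then show ?thesis using that lt unfolding omitting_def lt_structure_def by blast
  qed
  have powD: "(pred M ^^ i) x \<in> ?D" if "x \<in> ?D" for x i
    using that pD by (induction i) auto
  \<comment> \<open>As the parent \<open>x\<close> survives, only index \<open>0\<close> can expel a
    child.\<close>
  have ch: "children N x = {c \<in> children M x. \<not> (mth M c = P \<and> limit_node M P x)}" if x: "x \<in> ?D" for x
  proof -
    have "c \<in> ?D \<longleftrightarrow> \<not> (mth M c = P \<and> limit_node M P x)" if c: "c \<in> children M x" for c
    proof
      assume "c \<in> ?D"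
      then have "\<not> limit_child M P c" by (rule omitting_not_limit_child)
      then show "\<not> (mth M c = P \<and> limit_node M P x)" using c by (simp add: children_def limit_child_def)
    next
      assume n: "\<not> (mth M c = P \<and> limit_node M P x)"
      have "\<not> limit_child M P ((pred M ^^ i) c)" for i
      proof (cases i)
        case (Suc j)
        have "(pred M ^^ Suc j) c = (pred M ^^ j) x" using c by (simp add: children_def funpow_swap1)
        then show ?thesis using x by (simp add: Suc omitting_def)
      qed (use n c in \<open>simp add: children_def limit_child_def\<close>)
      then show "c \<in> ?D" using c by (simp add: omitting_def children_def)
    qed
    then show ?thesis using DM by (auto simp: children_def N_def)
  qed
  show sat: "msat N x p = msat M x p" if "x \<in> ?D" for x p
    using that
  proof (induction p arbitrary: x)
    case (Dia n p)
    have IH: "msat N c p = msat M c p" if "c \<in> children N x" for c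
      using that Dia.IH by (simp add: children_def N_def)
    show ?case
    proof (cases "limit_node M P x \<and> p \<in> P")
      case True
      then have "infinite {c \<in> children M x. msat M c p \<and> mth M c \<noteq> P}"
        unfolding P by (intro limit_node_infinite) auto
      moreover have "{c \<in> children M x. msat M c p \<and> mth M c \<noteq> P} \<subseteq> {c \<in> children N x. msat N c p}"
        using IH by (auto simp: ch[OF Dia.prems])
      moreover have "{c \<in> children M x. msat M c p \<and> mth M c \<noteq> P} \<subseteq> {c \<in> children M x. msat M c p}"
        by auto
      ultimately have "infinite {c \<in> children N x. msat N c p}" "infinite {c \<in> children M x. msat M c p}"
        by (blast dest: finite_subset)+
      then show ?thesis by (simp add: at_least_iff)
    next
      case False
      then have "msat M c p \<Longrightarrow> mth M c = P \<Longrightarrow> \<not> limit_node M P x" for c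
        by (auto simp: mth_def)
      then have "{c \<in> children N x. msat N c p} = {c \<in> children M x. msat M c p}"
        using IH by (auto simp: ch[OF Dia.prems])
      then show ?thesis by simp
    qed
  qed auto
  have meetD: "meet M x y \<in> ?D" if xy: "x \<in> ?D" "y \<in> ?D" for x y
  proof -
    have "x \<in> carrier M" "y \<in> carrier M" using xy DM by auto
    then have "le M (meet M x y) x" "meet M x y \<in> carrier M" "x \<in> carrier M"
      using M by (auto simp: bounded_tree_def lt_structure_def)
    then obtain i where "meet M x y = (pred M ^^ i) x"
      using M unfolding bounded_tree_def by blast
    then show ?thesis using powD[OF xy(1)] by simp
  qed
  have ltN: "lt_structure N"
    using eD pD meetD by (simp add: lt_structure_def N_def)
  show N: "bounded_tree d N"
    using M ltN DM unfolding bounded_tree_def N_def by (simp add: subset_iff)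
  show "Th N = Th M"
    by (rule Th_eq_if_msat_eq[OF N M]) (use sat eD in \<open>simp add: N_def\<close>)
  show "infinite ?D" if inf: "infinite (carrier M)"
  proof
    \<comment> \<open>A remaining limit node keeps infinitely many children. So a finite remainder
      contains no limit node and, by induction on the level, nothing was removed.\<close>
    assume fin: "finite ?D"
    have "x \<in> ?D" if "x \<in> carrier M" for x
      using that
    proof (induction "level M x" arbitrary: x)
      case 0
      have "(pred M ^^ level M x) x = eps M"
        unfolding level_def by (rule LeastI[of _ d]) (use M 0 in \<open>simp add: bounded_tree_def\<close>)
      then show ?case using 0 eD by simp
    next
      case (Suc n)
      have "x \<noteq> eps M"
      proof
        assume "x = eps M"
        then have "level M x = 0" by (simp add: level_def)
        then show False using Suc by simp
      qed
      then have xc: "x \<in> children M (pred M x)" using Suc by (simp add: children_def)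
      have "pred M x \<in> carrier M" using lt Suc by (simp add: lt_structure_def)
      then have px: "pred M x \<in> ?D" using Suc level_child[OF M xc] by simp
      have "MNot MFalse \<in> P" by (simp add: P mth_def)
      moreover have "finite {c \<in> children M (pred M x). msat M c (MNot MFalse) \<and> mth M c \<noteq> P}"
        by (rule finite_subset[OF _ fin])
          (use ch[OF px] in \<open>auto simp: N_def children_def set_eq_iff\<close>)
      ultimately have "\<not> limit_node M P (pred M x)"
        using limit_node_infinite[of M S' b "pred M x"] P by blast
      then have "x \<in> children N (pred M x)" using xc by (simp add: ch[OF px])
      then show ?case by (simp add: children_def N_def)
    qed
    then have "carrier M \<subseteq> ?D" by (rule subsetI)
    then show False using inf finite_subset[OF _ fin] by simp
  qed
qed

text \<open>Two countable models are compared: one inside the pruned \<open>M\<close>, one inside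
  the ultrapower and containing the limit node with its child realising \<open>P\<close>. An
  isomorphism would carry this child to a limit child of \<open>M\<close>, but pruning left
  none.\<close>

lemma categorical_finite_child_theories:
  assumes M: "bounded_tree d M" and inf: "infinite (carrier M)" and cat: "aleph0_categorical M"
    and a: "a \<in> carrier M"
  shows "finite (mth M ` children M a)"
proof (rule ccontr)
  assume "infinite (mth M ` children M a)"
  then obtain h :: "nat \<Rightarrow> mf set" where h: "inj h" "range h \<subseteq> mth M ` children M a"
    using infinite_countable_subset by blast
  then have "\<exists>c\<in>children M a. mth M c = h k" for k by (metis image_iff range_subsetD)
  then obtain b where b: "\<And>k. b k \<in> children M a" "\<And>k. mth M (b k) = h k" by metis
  have lt: "lt_structure M" using M by (simp add: bounded_tree_def)
  obtain U :: "nat filter" where "ultrapower U M"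
    using exists_free_ultrafilter lt by (auto simp: ultrapower_def)
  then interpret ultrapower U M .
  let ?a = "rep (\<lambda>_. a)" and ?b = "rep b"
  have bM: "b k \<in> carrier M" for k using b by (simp add: children_def)
  have aU: "?a \<in> carrier upow" and bU: "?b \<in> carrier upow" using a bM by auto
  have eva: "eventually (\<lambda>k. ?a k = a) U" using rep(2)[of "\<lambda>_. a"] a by simp
  have evb: "eventually (\<lambda>k. ?b k = b k) U" using rep(2)[of b] bM by simp
  have child: "?b \<in> children upow ?a"
    unfolding children_upow[OF aU bU] using eva evb by eventually_elim (use b in simp)
  define P where "P = mth upow ?b"
  have lim: "limit_node upow P ?a"
    unfolding limit_node_def
  proof
    fix p assume "p \<in> P"
    then have "eventually (\<lambda>k. msat M (?b k) p) U"
      using los_msat[OF bU] by (simp add: P_def mth_def)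
    with evb have evp: "eventually (\<lambda>k. msat M (b k) p) U" by eventually_elim simp
    \<comment> \<open>\<open>P\<close> may equal one of the theories \<open>h k\<close>, but by
      injectivity for one index only, and freeness of the filter discards it.\<close>
    have "finite {k. h k = P}"
      by (rule finite_subset[of _ "{inv h P}"]) (use h(1) in auto)
    then have "eventually (\<lambda>k. h k \<noteq> P) U" by (intro ev_cofinite) simp
    with evp have "eventually (\<lambda>k. msat M (b k) p \<and> h k \<noteq> P) U" by eventually_elim simp
    then obtain k where k: "msat M (b k) p" "h k \<noteq> P"
      using eventually_happens'[OF proper] by blast
    then obtain q where q: "q \<in> P" "\<not> msat M (b k) q"
      using mth_neq[of M "b k" upow ?b] b(2) by (auto simp: P_def)
    let ?p = "Dia (Suc 0) (MAnd p (MNot q))"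
    have "msat M a ?p" using k q b(1) by (auto simp: at_least_1)
    then have "eventually (\<lambda>k. msat M (?a k) ?p) U" using eva by (auto elim: eventually_mono)
    then show "\<exists>q\<in>P. msat upow ?a (Dia (Suc 0) (MAnd p (MNot q)))"
      using los_msat[OF aU] q by blast
  qed
  let ?D = "omitting M P"
  let ?N = "M\<lparr>carrier := ?D\<rparr>"
  note omit = omitting_msat[OF M P_def] omitting_bounded_tree[OF M P_def] omitting_Th[OF M P_def]
    omitting_infinite[OF M P_def inf]
  have ltN: "lt_structure ?N" and infN: "infinite (carrier ?N)"
    using omit(2,4) by (simp_all add: bounded_tree_def)
  obtain C where "C \<subseteq> carrier ?N" "lt_structure (?N\<lparr>carrier := C\<rparr>)" "Th (?N\<lparr>carrier := C\<rparr>) = Th ?N"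
    and satN: "\<And>x p. x \<in> C \<Longrightarrow> msat (?N\<lparr>carrier := C\<rparr>) x p = msat ?N x p"
    and C: "countable C" "infinite C"
    by (rule loewenheim_skolem[OF ltN countable_empty empty_subsetI infN]) (rule that)
  then have C': "C \<subseteq> ?D" "lt_structure (M\<lparr>carrier := C\<rparr>)" "Th (M\<lparr>carrier := C\<rparr>) = Th ?N"
    by simp_all
  have satC: "msat (M\<lparr>carrier := C\<rparr>) x p = msat M x p" if "x \<in> C" for x p
    using satN[OF that, of p] omit(1)[of x p] that C'(1) by auto
  have ab: "countable {?a, ?b}" "{?a, ?b} \<subseteq> carrier upow" using aU bU by auto
  obtain K where K: "countable K" "infinite K" "lt_structure (upow\<lparr>carrier := K\<rparr>)"
      "Th (upow\<lparr>carrier := K\<rparr>) = Th upow" and "{?a, ?b} \<subseteq> K"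
    and satK: "\<And>x p. x \<in> K \<Longrightarrow> msat (upow\<lparr>carrier := K\<rparr>) x p = msat upow x p"
    by (rule loewenheim_skolem[OF upow_structure ab infinite_upow[OF inf]]) (rule that)
  then have abK: "?a \<in> K" "?b \<in> K" by simp_all
  let ?S = "upow\<lparr>carrier := K\<rparr>" and ?S' = "M\<lparr>carrier := C\<rparr>"
  have "lt_iso ?S ?S'"
    by (rule aleph0_categorical_lt_iso[OF cat]) (use C C' K Th_upow omit(3) in simp_all)
  then obtain f where f: "iso_map f ?S ?S'" unfolding lt_iso_iff by blast
  have fC: "f x \<in> C" if "x \<in> K" for x using iso_map_closed[OF f] that by simp
  have sat: "msat M (f x) p = msat upow x p" if x: "x \<in> K" for x p
    using msat_iso[OF f K(3), of x p] satK[OF x] satC[OF fC[OF x]] x by simp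
  have "mth M (f ?b) = P" using sat[OF abK(2)] by (simp add: P_def mth_def)
  moreover have "limit_node M P (f ?a)"
    using lim unfolding limit_node_def sat[OF abK(1)] .
  moreover have "pred M (f ?b) = f ?a" "f ?b \<noteq> eps M"
  proof -
    have e: "pred upow ?b = ?a" "?b \<noteq> eps upow" using child by (auto simp: children_def)
    have "f (pred ?S ?b) = pred ?S' (f ?b)" "f (eps ?S) = eps ?S'" "inj_on f K"
      using f abK(2) by (simp_all add: iso_map_def bij_betw_def)
    moreover have "eps upow \<in> K" using K(3) by (simp add: lt_structure_def)
    ultimately show "pred M (f ?b) = f ?a" "f ?b \<noteq> eps M"
      using e abK(2) inj_on_eq_iff[of f K ?b "eps upow"] by auto
  qed
  moreover have "f ?b \<in> ?D" using fC[OF abK(2)] C'(1) by blast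
  then have "\<not> limit_child M P (f ?b)" by (rule omitting_not_limit_child)
  ultimately show False by (simp add: limit_child_def)
qed

theorem mainTheorem13:
  fixes M :: "'a lt_struct"
  assumes "is_tree M"
    and "finite (carrier M) \<or> (infinite (carrier M) \<and> aleph0_categorical M)"
  shows "\<exists>\<Gamma> lam. tree_plan \<Gamma> lam \<and> Th M = Th (Gamma_omega_tree \<Gamma> lam)"
proof -
  have "\<exists>d. bounded_tree d M \<and> (\<forall>x\<in>carrier M. finite (mth M ` children M x))"
  proof (cases "finite (carrier M)")
    case True
    obtain n where n: "\<And>x. x \<in> carrier M \<Longrightarrow> (pred M ^^ n x) x = eps M"
      using tree_height_finite[OF assms(1)] by metis
    have "(pred M ^^ Max (n ` carrier M)) x = eps M" if x: "x \<in> carrier M" for x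
    proof -
      have "n x \<le> Max (n ` carrier M)" using True x by simp
      then obtain m where "Max (n ` carrier M) = m + n x" by (metis add.commute le_Suc_ex)
      then show ?thesis
        using n[OF x] pred_pow_eps[OF is_treeD(2)[OF assms(1)]] by (simp add: funpow_add)
    qed
    then have "bounded_tree (Max (n ` carrier M)) M" by (rule bounded_tree_if_tree[OF assms(1)])
    moreover have "finite (mth M ` children M x)" for x
      by (rule finite_imageI, rule finite_subset[OF _ True]) (auto simp: children_def)
    ultimately show ?thesis by blast
  next
    case False
    then have cat: "aleph0_categorical M" using assms(2) by simp
    obtain d where d: "bounded_tree d M" using categorical_height_bounded[OF assms(1) False cat] ..
    then show ?thesis using categorical_finite_child_theories[OF d False cat] by blast
  qed
  then obtain d where d: "bounded_tree d M" and fin: "\<And>x. x \<in> carrier M \<Longrightarrow> finite (mth M ` children M x)"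
    by blast
  have "eps M \<in> carrier M" using d by (simp add: bounded_tree_def lt_structure_def)
  then obtain \<Gamma> lam where plan: "tree_plan \<Gamma> lam"
    and sat: "\<And>p. msat (Gamma_omega_tree \<Gamma> lam) [] p = msat M (eps M) p"
    using exists_tree_plan[OF d fin] by blast
  obtain e where "bounded_tree e (Gamma_omega_tree \<Gamma> lam)" using bounded_tree_Gamma_omega[OF plan] ..
  \<comment> \<open>The game runs with a single height bound for both trees.\<close>
  then have "bounded_tree (max d e) (Gamma_omega_tree \<Gamma> lam)" by (rule bounded_tree_mono) simp
  moreover have "bounded_tree (max d e) M" by (rule bounded_tree_mono[OF d]) simp
  ultimately have "Th M = Th (Gamma_omega_tree \<Gamma> lam)"
    by (intro Th_eq_if_msat_eq) (use sat in auto)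
  then show ?thesis using plan by blast
qed

end
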